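(* Let $L \colon \mathcal{A} \to \mathcal{C}$ and $U \colon \mathcal{C} \to \mathcal{A}$ be functors forming an adjunction $L \dashv U$ with counit $\epsilon \colon LU \to \mathrm{id}_{\mathcal{C}}$. Assume that $\epsilon$ is a cartesian natural transformation and that every component of $\epsilon$ is a monomorphism. If $L$ is fully faithful, then for every effective descent morphism $p$ in $\mathcal{C}$ such that $L$ preserves pullbacks along $U(p)$, the morphism $U(p)$ is an effective descent morphism in $\mathcal{A}$.
   Context: A morphism $p \colon a \to b$ in a category $\mathcal{X}$ is an effective descent morphism if all pullbacks along $p$ exist in $\mathcal{X}$ (equivalently, the functor $p_! \colon \mathcal{X} \downarrow a \to \mathcal{X} \downarrow b$, $f \mapsto p \circ f$, between slice categories has a right adjoint $p^*$, given by pullback along $p$) and the functor $p^* \colon \mathcal{X}\downarrow b \to \mathcal{X} \downarrow a$ is monadic (its comparison functor into the Eilenberg-Moore category of the monad induced by $p_! \dashv p^*$ is an equivalence). No existence of other pullbacks in $\mathcal{X}$ is assumed. A natural transformation is cartesian if all of its naturality squares are pullback squares. *)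

theory Defs
  imports Main
begin

section \<open>Categories, functors, natural transformations\<close>

text \<open>Composition is written in the order of function composition:
  \<open>g \<cdot>\<^bsub>C\<^esub> f\<close> is \<open>g\<close> after \<open>f\<close>, and is only meaningful if
  \<open>Dom C g = Cod C f\<close>.\<close>

record ('o, 'm) cat =
  Obj :: "'o set"
  Arr :: "'m set"
  Dom :: "'m \<Rightarrow> 'o"
  Cod :: "'m \<Rightarrow> 'o"
  Ident :: "'o \<Rightarrow> 'm"
  Comp :: "'m \<Rightarrow> 'm \<Rightarrow> 'm"  (infixr \<open>\<cdot>\<index>\<close> 70)

definition hom :: "('o, 'm) cat \<Rightarrow> 'o \<Rightarrow> 'o \<Rightarrow> 'm set" where
  "hom C x y = {f \<in> Arr C. Dom C f = x \<and> Cod C f = y}"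

locale category =
  fixes C :: "('o, 'm) cat" (structure)
  assumes Dom_Obj: "f \<in> Arr C \<Longrightarrow> Dom C f \<in> Obj C"
    and Cod_Obj: "f \<in> Arr C \<Longrightarrow> Cod C f \<in> Obj C"
    and Ident_hom: "x \<in> Obj C \<Longrightarrow> Ident C x \<in> hom C x x"
    and Comp_hom: "\<lbrakk>f \<in> hom C x y; g \<in> hom C y z\<rbrakk> \<Longrightarrow> g \<cdot> f \<in> hom C x z"
    and Comp_Ident_left: "f \<in> hom C x y \<Longrightarrow> Ident C y \<cdot> f = f"
    and Comp_Ident_right: "f \<in> hom C x y \<Longrightarrow> f \<cdot> Ident C x = f"
    and Comp_assoc: "\<lbrakk>f \<in> hom C w x; g \<in> hom C x y; h \<in> hom C y z\<rbrakk>
      \<Longrightarrow> (h \<cdot> g) \<cdot> f = h \<cdot> (g \<cdot> f)"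

record ('o1, 'm1, 'o2, 'm2) func =
  ObjMap :: "'o1 \<Rightarrow> 'o2"
  ArrMap :: "'m1 \<Rightarrow> 'm2"

locale is_functor = A: category A + B: category B
  for A :: "('o1, 'm1) cat" and B :: "('o2, 'm2) cat" +
  fixes F :: "('o1, 'm1, 'o2, 'm2) func"
  assumes ObjMap_Obj: "x \<in> Obj A \<Longrightarrow> ObjMap F x \<in> Obj B"
    and ArrMap_hom: "f \<in> hom A x y \<Longrightarrow> ArrMap F f \<in> hom B (ObjMap F x) (ObjMap F y)"
    and ArrMap_Ident: "x \<in> Obj A \<Longrightarrow> ArrMap F (Ident A x) = Ident B (ObjMap F x)"
    and ArrMap_Comp: "\<lbrakk>f \<in> hom A x y; g \<in> hom A y z\<rbrakk>
      \<Longrightarrow> ArrMap F (g \<cdot>\<^bsub>A\<^esub> f) = ArrMap F g \<cdot>\<^bsub>B\<^esub> ArrMap F f"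

definition id_func :: "('o, 'm, 'o, 'm) func" where
  "id_func = \<lparr>ObjMap = (\<lambda>x. x), ArrMap = (\<lambda>f. f)\<rparr>"

definition comp_func ::
  "('o2, 'm2, 'o3, 'm3) func \<Rightarrow> ('o1, 'm1, 'o2, 'm2) func \<Rightarrow> ('o1, 'm1, 'o3, 'm3) func"
  (infixr \<open>\<circ>\<^sub>F\<close> 70) where
  "G \<circ>\<^sub>F F = \<lparr>ObjMap = (\<lambda>x. ObjMap G (ObjMap F x)), ArrMap = (\<lambda>f. ArrMap G (ArrMap F f))\<rparr>"

locale nat_trans = F: is_functor A B F + G: is_functor A B G
  for A :: "('o1, 'm1) cat" and B :: "('o2, 'm2) cat" and F G +
  fixes t :: "'o1 \<Rightarrow> 'm2"
  assumes component_hom: "x \<in> Obj A \<Longrightarrow> t x \<in> hom B (ObjMap F x) (ObjMap G x)"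
    and naturality: "f \<in> hom A x y \<Longrightarrow> ArrMap G f \<cdot>\<^bsub>B\<^esub> t x = t y \<cdot>\<^bsub>B\<^esub> ArrMap F f"

definition full_faithful ::
  "('o1, 'm1) cat \<Rightarrow> ('o2, 'm2) cat \<Rightarrow> ('o1, 'm1, 'o2, 'm2) func \<Rightarrow> bool" where
  "full_faithful A B F \<longleftrightarrow> is_functor A B F \<and>
    (\<forall>x \<in> Obj A. \<forall>y \<in> Obj A.
      bij_betw (ArrMap F) (hom A x y) (hom B (ObjMap F x) (ObjMap F y)))"

definition is_iso :: "('o, 'm) cat \<Rightarrow> 'm \<Rightarrow> bool" where
  "is_iso C f \<longleftrightarrow> f \<in> Arr C \<and>
    (\<exists>g \<in> hom C (Cod C f) (Dom C f).
      g \<cdot>\<^bsub>C\<^esub> f = Ident C (Dom C f) \<and> f \<cdot>\<^bsub>C\<^esub> g = Ident C (Cod C f))"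

definition is_monic :: "('o, 'm) cat \<Rightarrow> 'm \<Rightarrow> bool" where
  "is_monic C m \<longleftrightarrow> m \<in> Arr C \<and>
    (\<forall>x \<in> Obj C. \<forall>f \<in> hom C x (Dom C m). \<forall>g \<in> hom C x (Dom C m).
      m \<cdot>\<^bsub>C\<^esub> f = m \<cdot>\<^bsub>C\<^esub> g \<longrightarrow> f = g)"

definition nat_iso where
  "nat_iso A B F G t \<longleftrightarrow> nat_trans A B F G t \<and> (\<forall>x \<in> Obj A. is_iso B (t x))"

definition is_equivalence ::
  "('o1, 'm1) cat \<Rightarrow> ('o2, 'm2) cat \<Rightarrow> ('o1, 'm1, 'o2, 'm2) func \<Rightarrow> bool" where
  "is_equivalence A B F \<longleftrightarrow> is_functor A B F \<and>
    (\<exists>G s t. is_functor B A G \<and> nat_iso A A id_func (G \<circ>\<^sub>F F) s \<and> nat_iso B B (F \<circ>\<^sub>F G) id_func t)"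


section \<open>Pullbacks\<close>

text \<open>\<open>is_pullback C f g p q\<close>: the square \<open>f \<cdot> p = g \<cdot> q\<close> is a pullback of the cospan \<open>(f, g)\<close>.\<close>

definition is_pullback :: "('o, 'm) cat \<Rightarrow> 'm \<Rightarrow> 'm \<Rightarrow> 'm \<Rightarrow> 'm \<Rightarrow> bool" where
  "is_pullback C f g p q \<longleftrightarrow>
    f \<in> Arr C \<and> g \<in> Arr C \<and> Cod C f = Cod C g \<and>
    p \<in> hom C (Dom C p) (Dom C f) \<and> q \<in> hom C (Dom C p) (Dom C g) \<and>
    f \<cdot>\<^bsub>C\<^esub> p = g \<cdot>\<^bsub>C\<^esub> q \<and>
    (\<forall>x \<in> Obj C. \<forall>h \<in> hom C x (Dom C f). \<forall>k \<in> hom C x (Dom C g).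
      f \<cdot>\<^bsub>C\<^esub> h = g \<cdot>\<^bsub>C\<^esub> k \<longrightarrow>
        (\<exists>!u. u \<in> hom C x (Dom C p) \<and> p \<cdot>\<^bsub>C\<^esub> u = h \<and> q \<cdot>\<^bsub>C\<^esub> u = k))"

definition has_pullbacks_along :: "('o, 'm) cat \<Rightarrow> 'm \<Rightarrow> bool" where
  "has_pullbacks_along C p \<longleftrightarrow> p \<in> Arr C \<and>
    (\<forall>f \<in> Arr C. Cod C f = Cod C p \<longrightarrow> (\<exists>q r. is_pullback C p f q r))"

text \<open>Only those pullbacks along \<open>q\<close> that exist in \<open>A\<close> are required to be preserved;
  their existence is not part of the condition.\<close>

definition preserves_pullbacks_along ::
  "('o1, 'm1) cat \<Rightarrow> ('o2, 'm2) cat \<Rightarrow> ('o1, 'm1, 'o2, 'm2) func \<Rightarrow> 'm1 \<Rightarrow> bool" where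
  "preserves_pullbacks_along A B F q \<longleftrightarrow>
    (\<forall>f r s. is_pullback A q f r s \<longrightarrow>
      is_pullback B (ArrMap F q) (ArrMap F f) (ArrMap F r) (ArrMap F s))"

definition cartesian_nat_trans where
  "cartesian_nat_trans A B F G t \<longleftrightarrow> nat_trans A B F G t \<and>
    (\<forall>f \<in> Arr A. is_pullback B (ArrMap G f) (t (Cod A f)) (t (Dom A f)) (ArrMap F f))"


section \<open>Adjunctions and monadicity\<close>

locale adjunction =
  F: is_functor A B F + G: is_functor B A G +
  unit: nat_trans A A id_func "G \<circ>\<^sub>F F" \<eta> + counit: nat_trans B B "F \<circ>\<^sub>F G" id_func \<epsilon>
  for A :: "('o1, 'm1) cat" and B :: "('o2, 'm2) cat" and F G \<eta> \<epsilon> +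
  assumes triangle_left:
      "x \<in> Obj A \<Longrightarrow> \<epsilon> (ObjMap F x) \<cdot>\<^bsub>B\<^esub> ArrMap F (\<eta> x) = Ident B (ObjMap F x)"
    and triangle_right:
      "y \<in> Obj B \<Longrightarrow> ArrMap G (\<epsilon> y) \<cdot>\<^bsub>A\<^esub> \<eta> (ObjMap G y) = Ident A (ObjMap G y)"

text \<open>The Eilenberg--Moore category of a monad \<open>(T, \<eta>, \<mu>)\<close> on \<open>A\<close>. A morphism carries
  its source and target algebras, so that \<open>Dom\<close> and \<open>Cod\<close> are determined.\<close>

definition algebras ::
  "('o, 'm) cat \<Rightarrow> ('o, 'm, 'o, 'm) func \<Rightarrow> ('o \<Rightarrow> 'm) \<Rightarrow> ('o \<Rightarrow> 'm) \<Rightarrow> ('o \<times> 'm) set" where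
  "algebras A T \<eta> \<mu> = {(x, a). x \<in> Obj A \<and> a \<in> hom A (ObjMap T x) x \<and>
     a \<cdot>\<^bsub>A\<^esub> \<eta> x = Ident A x \<and> a \<cdot>\<^bsub>A\<^esub> \<mu> x = a \<cdot>\<^bsub>A\<^esub> ArrMap T a}"

definition EM_cat ::
  "('o, 'm) cat \<Rightarrow> ('o, 'm, 'o, 'm) func \<Rightarrow> ('o \<Rightarrow> 'm) \<Rightarrow> ('o \<Rightarrow> 'm) \<Rightarrow>
    ('o \<times> 'm, ('o \<times> 'm) \<times> 'm \<times> ('o \<times> 'm)) cat" where
  "EM_cat A T \<eta> \<mu> = \<lparr>
     Obj = algebras A T \<eta> \<mu>,
     Arr = {((x, a), h, (y, b)). (x, a) \<in> algebras A T \<eta> \<mu> \<and> (y, b) \<in> algebras A T \<eta> \<mu> \<and>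
       h \<in> hom A x y \<and> h \<cdot>\<^bsub>A\<^esub> a = b \<cdot>\<^bsub>A\<^esub> ArrMap T h},
     Dom = (\<lambda>(s, h, t). s),
     Cod = (\<lambda>(s, h, t). t),
     Ident = (\<lambda>s. (s, Ident A (fst s), s)),
     Comp = (\<lambda>(s', k, t') (s, h, t). (s, k \<cdot>\<^bsub>A\<^esub> h, t'))\<rparr>"

definition adj_EM_cat where
  "adj_EM_cat A F G \<eta> \<epsilon> =
     EM_cat A (G \<circ>\<^sub>F F) \<eta> (\<lambda>x. ArrMap G (\<epsilon> (ObjMap F x)))"

definition comparison ::
  "('o2, 'm2) cat \<Rightarrow> ('o2, 'm2, 'o1, 'm1) func \<Rightarrow> ('o2 \<Rightarrow> 'm2) \<Rightarrow>
    ('o2, 'm2, 'o1 \<times> 'm1, ('o1 \<times> 'm1) \<times> 'm1 \<times> ('o1 \<times> 'm1)) func" where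
  "comparison B G \<epsilon> =
    (let K = (\<lambda>y. (ObjMap G y, ArrMap G (\<epsilon> y)))
     in \<lparr>ObjMap = K, ArrMap = (\<lambda>f. (K (Dom B f), ArrMap G f, K (Cod B f)))\<rparr>)"

definition monadic_adjunction where
  "monadic_adjunction A B F G \<eta> \<epsilon> \<longleftrightarrow>
     adjunction A B F G \<eta> \<epsilon> \<and> is_equivalence B (adj_EM_cat A F G \<eta> \<epsilon>) (comparison B G \<epsilon>)"


section \<open>Slices and effective descent\<close>

text \<open>The slice of \<open>C\<close> over \<open>b\<close>. An arrow from \<open>f\<close> to \<open>g\<close> is a triple \<open>(f, h, g)\<close> with
  \<open>g \<cdot> h = f\<close>.\<close>

definition slice :: "('o, 'm) cat \<Rightarrow> 'o \<Rightarrow> ('m, 'm \<times> 'm \<times> 'm) cat" where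
  "slice C b = \<lparr>
     Obj = {f \<in> Arr C. Cod C f = b},
     Arr = {(f, h, g). f \<in> Arr C \<and> Cod C f = b \<and> g \<in> Arr C \<and> Cod C g = b \<and>
       h \<in> hom C (Dom C f) (Dom C g) \<and> g \<cdot>\<^bsub>C\<^esub> h = f},
     Dom = (\<lambda>(f, h, g). f),
     Cod = (\<lambda>(f, h, g). g),
     Ident = (\<lambda>f. (f, Ident C (Dom C f), f)),
     Comp = (\<lambda>(f', k, g') (f, h, g). (f, k \<cdot>\<^bsub>C\<^esub> h, g'))\<rparr>"

definition slice_post :: "('o, 'm) cat \<Rightarrow> 'm \<Rightarrow> ('m, 'm \<times> 'm \<times> 'm, 'm, 'm \<times> 'm \<times> 'm) func" where
  "slice_post C p = \<lparr>
     ObjMap = (\<lambda>f. p \<cdot>\<^bsub>C\<^esub> f),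
     ArrMap = (\<lambda>(f, h, g). (p \<cdot>\<^bsub>C\<^esub> f, h, p \<cdot>\<^bsub>C\<^esub> g))\<rparr>"

text \<open>\<open>P\<close> is a functor \<open>p\<^sup>*\<close>, right adjoint to \<open>p\<^sub>!\<close> and given by pullback along \<open>p\<close>:
  \<open>P f\<close> and the arrow underlying the counit at \<open>f\<close> (the middle entry of the triple)
  are the two projections of a pullback of \<open>p\<close> and \<open>f\<close>.\<close>

definition pullback_adjunction where
  "pullback_adjunction C p P \<eta> \<epsilon> \<longleftrightarrow>
     adjunction (slice C (Dom C p)) (slice C (Cod C p)) (slice_post C p) P \<eta> \<epsilon> \<and>
     (\<forall>f \<in> Obj (slice C (Cod C p)). is_pullback C p f (ObjMap P f) (fst (snd (\<epsilon> f))))"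

text \<open>The functor \<open>p\<^sup>*\<close> depends on a choice of pullbacks, but any two choices are
  isomorphic compatibly with the adjunctions, so monadicity does not depend on the choice.\<close>

definition effective_descent :: "('o, 'm) cat \<Rightarrow> 'm \<Rightarrow> bool" where
  "effective_descent C p \<longleftrightarrow> has_pullbacks_along C p \<and>
    (\<exists>P \<eta> \<epsilon>. pullback_adjunction C p P \<eta> \<epsilon> \<and>
      monadic_adjunction (slice C (Dom C p)) (slice C (Cod C p)) (slice_post C p) P \<eta> \<epsilon>)"


section \<open>Well-formedness of the constructions\<close>

lemma slice_category:
  assumes "category C" shows "category (slice C b)"
proof -
  interpret category C by fact
  show ?thesis
  proof
    fix f x y g z assume "f \<in> hom (slice C b) x y" "g \<in> hom (slice C b) y z"
    then obtain h k where e: "f = (x, h, y)" "g = (y, k, z)" "x \<in> Arr C" "z \<in> Arr C"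
        "Cod C x = b" "Cod C z = b"
        "h \<in> hom C (Dom C x) (Dom C y)" "k \<in> hom C (Dom C y) (Dom C z)"
        "y \<cdot>\<^bsub>C\<^esub> h = x" "z \<cdot>\<^bsub>C\<^esub> k = y"
      by (auto simp: slice_def hom_def)
    have "z \<in> hom C (Dom C z) b" using e by (simp add: hom_def)
    from Comp_assoc[OF e(7,8) this] have "z \<cdot>\<^bsub>C\<^esub> (k \<cdot>\<^bsub>C\<^esub> h) = x" using e by simp
    then show "g \<cdot>\<^bsub>slice C b\<^esub> f \<in> hom (slice C b) x z"
      using e Comp_hom[OF e(7,8)] by (simp add: slice_def hom_def)
  next
    fix x assume "x \<in> Obj (slice C b)"
    then have x: "x \<in> hom C (Dom C x) b" "x \<in> Arr C" by (auto simp: slice_def hom_def)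
    then show "Ident (slice C b) x \<in> hom (slice C b) x x"
      using Ident_hom[OF Dom_Obj[OF x(2)]] Comp_Ident_right[OF x(1)]
      by (simp add: slice_def hom_def)
  next
    fix f x y assume "f \<in> hom (slice C b) x y"
    then obtain h where "f = (x, h, y)" "h \<in> hom C (Dom C x) (Dom C y)"
      by (auto simp: slice_def hom_def)
    then show "Ident (slice C b) y \<cdot>\<^bsub>slice C b\<^esub> f = f" "f \<cdot>\<^bsub>slice C b\<^esub> Ident (slice C b) x = f"
      using Comp_Ident_left[of h] Comp_Ident_right[of h] by (simp_all add: slice_def)
  next
    fix f w x g y h z
    assume "f \<in> hom (slice C b) w x" "g \<in> hom (slice C b) x y" "h \<in> hom (slice C b) y z"
    then obtain f' g' h' where "f = (w, f', x)" "g = (x, g', y)" "h = (y, h', z)"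
        "f' \<in> hom C (Dom C w) (Dom C x)" "g' \<in> hom C (Dom C x) (Dom C y)"
        "h' \<in> hom C (Dom C y) (Dom C z)"
      by (auto simp: slice_def hom_def)
    then show "(h \<cdot>\<^bsub>slice C b\<^esub> g) \<cdot>\<^bsub>slice C b\<^esub> f = h \<cdot>\<^bsub>slice C b\<^esub> (g \<cdot>\<^bsub>slice C b\<^esub> f)"
      using Comp_assoc by (simp add: slice_def)
  qed (auto simp: slice_def)
qed

lemma slice_post_functor:
  assumes "category C" "p \<in> Arr C"
  shows "is_functor (slice C (Dom C p)) (slice C (Cod C p)) (slice_post C p)"
proof -
  interpret category C by fact
  interpret S: category "slice C (Dom C p)" by (rule slice_category[OF assms(1)])
  interpret T: category "slice C (Cod C p)" by (rule slice_category[OF assms(1)])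
  have p: "p \<in> hom C (Dom C p) (Cod C p)" using assms(2) by (simp add: hom_def)
  have pf: "p \<cdot>\<^bsub>C\<^esub> f \<in> Arr C" "Dom C (p \<cdot>\<^bsub>C\<^esub> f) = Dom C f" "Cod C (p \<cdot>\<^bsub>C\<^esub> f) = Cod C p"
    if "f \<in> Arr C" "Cod C f = Dom C p" for f
    using Comp_hom[of f "Dom C f" "Dom C p", OF _ p] that by (auto simp: hom_def)
  show ?thesis
  proof
    fix f x y assume "f \<in> hom (slice C (Dom C p)) x y"
    then obtain h where e: "f = (x, h, y)" "x \<in> Arr C" "y \<in> Arr C"
        "Cod C x = Dom C p" "Cod C y = Dom C p" "h \<in> hom C (Dom C x) (Dom C y)" "y \<cdot>\<^bsub>C\<^esub> h = x"
      by (auto simp: slice_def hom_def)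
    have "y \<in> hom C (Dom C y) (Dom C p)" using e by (simp add: hom_def)
    from Comp_assoc[OF e(6) this p] have "(p \<cdot>\<^bsub>C\<^esub> y) \<cdot>\<^bsub>C\<^esub> h = p \<cdot>\<^bsub>C\<^esub> x" using e by simp
    then show "ArrMap (slice_post C p) f
        \<in> hom (slice C (Cod C p)) (ObjMap (slice_post C p) x) (ObjMap (slice_post C p) y)"
      using e pf by (simp add: slice_def hom_def slice_post_def)
  qed (auto simp: slice_def hom_def slice_post_def pf)
qed

lemma EM_category:
  assumes "is_functor A A T" shows "category (EM_cat A T \<eta> \<mu>)"
proof -
  interpret is_functor A A T by fact
  show ?thesis
  proof
    fix f x y g z assume a: "f \<in> hom (EM_cat A T \<eta> \<mu>) x y" "g \<in> hom (EM_cat A T \<eta> \<mu>) y z"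
    obtain x1 x2 y1 y2 z1 z2 h k where e: "x=(x1,x2)" "y=(y1,y2)" "z=(z1,z2)" "f=(x,h,y)" "g=(y,k,z)"
      using a by (auto simp: EM_cat_def hom_def)
    have al: "(x1,x2)\<in>algebras A T \<eta> \<mu>" "(y1,y2)\<in>algebras A T \<eta> \<mu>" "(z1,z2)\<in>algebras A T \<eta> \<mu>"
      and hk: "h \<in> hom A x1 y1" "k \<in> hom A y1 z1" 
      "h \<cdot>\<^bsub>A\<^esub> x2 = y2 \<cdot>\<^bsub>A\<^esub> ArrMap T h" "k \<cdot>\<^bsub>A\<^esub> y2 = z2 \<cdot>\<^bsub>A\<^esub> ArrMap T k"
      using a e by (auto simp: EM_cat_def hom_def)
    have al': "x2 \<in> hom A (ObjMap T x1) x1" "y2 \<in> hom A (ObjMap T y1) y1" "z2 \<in> hom A (ObjMap T z1) z1"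
      using al by (auto simp: algebras_def)
    have "(k \<cdot>\<^bsub>A\<^esub> h) \<cdot>\<^bsub>A\<^esub> x2 = z2 \<cdot>\<^bsub>A\<^esub> ArrMap T (k \<cdot>\<^bsub>A\<^esub> h)"
      using A.Comp_assoc[OF al'(1) hk(1,2)] A.Comp_assoc[OF ArrMap_hom[OF hk(1)] al'(2) hk(2)] A.Comp_assoc[OF ArrMap_hom[OF hk(1)] ArrMap_hom[OF hk(2)] al'(3)] ArrMap_Comp[OF hk(1,2)] hk by simp
    then show "g \<cdot>\<^bsub>EM_cat A T \<eta> \<mu>\<^esub> f \<in> hom (EM_cat A T \<eta> \<mu>) x z"
      using al hk A.Comp_hom e by (auto simp: EM_cat_def hom_def)
  next
    fix x assume "x \<in> Obj (EM_cat A T \<eta> \<mu>)"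
    then show "Ident (EM_cat A T \<eta> \<mu>) x \<in> hom (EM_cat A T \<eta> \<mu>) x x"
      using A.Ident_hom A.Comp_Ident_left A.Comp_Ident_right ArrMap_Ident
      by (fastforce simp: EM_cat_def hom_def algebras_def)
  next
    fix f x y assume "f \<in> hom (EM_cat A T \<eta> \<mu>) x y"
    then show "Ident (EM_cat A T \<eta> \<mu>) y \<cdot>\<^bsub>EM_cat A T \<eta> \<mu>\<^esub> f = f"
     "f \<cdot>\<^bsub>EM_cat A T \<eta> \<mu>\<^esub> Ident (EM_cat A T \<eta> \<mu>) x = f"
      using A.Comp_Ident_left A.Comp_Ident_right by (fastforce simp: EM_cat_def hom_def)+
  next
    fix f w x g y h z assume "f \<in> hom (EM_cat A T \<eta> \<mu>) w x" "g \<in> hom (EM_cat A T \<eta> \<mu>) x y" "h \<in> hom (EM_cat A T \<eta> \<mu>) y z"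
    then show "(h \<cdot>\<^bsub>EM_cat A T \<eta> \<mu>\<^esub> g) \<cdot>\<^bsub>EM_cat A T \<eta> \<mu>\<^esub> f = h \<cdot>\<^bsub>EM_cat A T \<eta> \<mu>\<^esub> (g \<cdot>\<^bsub>EM_cat A T \<eta> \<mu>\<^esub> f)"
      using A.Comp_assoc by (fastforce simp: EM_cat_def hom_def)
  qed (auto simp: EM_cat_def)
qed

lemma comparison_functor:
  assumes "adjunction A B F G \<eta> \<epsilon>"
  shows "is_functor B (adj_EM_cat A F G \<eta> \<epsilon>) (comparison B G \<epsilon>)"
proof -
  interpret adjunction A B F G \<eta> \<epsilon> by fact
  interpret E: category "adj_EM_cat A F G \<eta> \<epsilon>"
    unfolding adj_EM_cat_def by (rule EM_category) unfold_locales
  have ch: "\<epsilon> y \<in> hom B (ObjMap F (ObjMap G y)) y" if "y \<in> Obj B" for y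
    using counit.component_hom[OF that] by (simp add: comp_func_def id_func_def)
  have nat: "f \<cdot>\<^bsub>B\<^esub> \<epsilon> x = \<epsilon> y \<cdot>\<^bsub>B\<^esub> ArrMap F (ArrMap G f)" if "f \<in> hom B x y" for f x y
    using counit.naturality[OF that] by (simp add: comp_func_def id_func_def)
  have obj: "(ObjMap G y, ArrMap G (\<epsilon> y)) \<in> algebras A (G \<circ>\<^sub>F F) \<eta> (\<lambda>x. ArrMap G (\<epsilon> (ObjMap F x)))" if y: "y \<in> Obj B" for y
  proof -
    let ?FG = "ObjMap F (ObjMap G y)"
    have o: "ObjMap G y \<in> Obj A" "?FG \<in> Obj B" using y by (auto intro: G.ObjMap_Obj F.ObjMap_Obj)
    have "ArrMap G (\<epsilon> y \<cdot>\<^bsub>B\<^esub> \<epsilon> ?FG) = ArrMap G (\<epsilon> y \<cdot>\<^bsub>B\<^esub> ArrMap F (ArrMap G (\<epsilon> y)))"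
      using nat[OF ch[OF y]] by simp
    then show ?thesis
      using ch[OF y] ch[OF o(2)] o y triangle_right[OF y]
        G.ArrMap_Comp[OF ch[OF o(2)] ch[OF y]]
        G.ArrMap_Comp[OF F.ArrMap_hom[OF G.ArrMap_hom[OF ch[OF y]]] ch[OF y]]
        G.ArrMap_hom[OF ch[OF y]]
      by (auto simp: algebras_def comp_func_def)
  qed
  show ?thesis
  proof
    fix x assume "x \<in> Obj B"
    then show "ObjMap (comparison B G \<epsilon>) x \<in> Obj (adj_EM_cat A F G \<eta> \<epsilon>)"
      using obj by (auto simp: adj_EM_cat_def EM_cat_def comparison_def Let_def)
    from \<open>x \<in> Obj B\<close> show "ArrMap (comparison B G \<epsilon>) (Ident B x) = Ident (adj_EM_cat A F G \<eta> \<epsilon>) (ObjMap (comparison B G \<epsilon>) x)"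
      using F.B.Ident_hom[of x] G.ArrMap_Ident by (auto simp: adj_EM_cat_def EM_cat_def comparison_def Let_def hom_def)
  next
    fix f x y assume f: "f \<in> hom B x y"
    then have xy: "x \<in> Obj B" "y \<in> Obj B" "Dom B f = x" "Cod B f = y" using F.B.Dom_Obj F.B.Cod_Obj by (auto simp: hom_def)
    have "ArrMap G (f \<cdot>\<^bsub>B\<^esub> \<epsilon> x) = ArrMap G (\<epsilon> y \<cdot>\<^bsub>B\<^esub> ArrMap F (ArrMap G f))" using nat f by simp
    then have "ArrMap G f \<cdot>\<^bsub>A\<^esub> ArrMap G (\<epsilon> x) = ArrMap G (\<epsilon> y) \<cdot>\<^bsub>A\<^esub> ArrMap G (ArrMap F (ArrMap G f))"
      using G.ArrMap_Comp[OF ch[OF xy(1)] f] G.ArrMap_Comp[OF F.ArrMap_hom[OF G.ArrMap_hom[OF f]] ch[OF xy(2)]] by simp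
    then show "ArrMap (comparison B G \<epsilon>) f \<in> hom (adj_EM_cat A F G \<eta> \<epsilon>) (ObjMap (comparison B G \<epsilon>) x) (ObjMap (comparison B G \<epsilon>) y)"
      using xy obj G.ArrMap_hom[OF f]
      by (auto simp: adj_EM_cat_def EM_cat_def comparison_def Let_def hom_def comp_func_def)
  next
    fix f x y g z assume f: "f \<in> hom B x y" and g: "g \<in> hom B y z"
    then show "ArrMap (comparison B G \<epsilon>) (g \<cdot>\<^bsub>B\<^esub> f) = ArrMap (comparison B G \<epsilon>) g \<cdot>\<^bsub>adj_EM_cat A F G \<eta> \<epsilon>\<^esub> ArrMap (comparison B G \<epsilon>) f"
      using F.B.Comp_hom[OF f g] G.ArrMap_Comp[OF f g]
      by (auto simp: adj_EM_cat_def EM_cat_def comparison_def Let_def hom_def)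
  qed
qed

end

theory Submission
  imports Defs
begin

text \<open>
  Since \<open>L\<close> is fully faithful, it makes \<open>A\<close> a full coreflective subcategory of \<open>C\<close>. Cartesianness of
  the counit makes this subcategory a sieve: an arrow \<open>d \<rightarrow> L x\<close> exhibits \<open>\<epsilon> d\<close> as a pullback of
  \<open>\<epsilon> (L x)\<close>, which is invertible, so \<open>\<epsilon> d\<close> is invertible too (lemma
  \<open>counit_iso_of_arrow_into_image\<close>). Transposition therefore identifies the slice of \<open>A\<close> over \<open>U c\<close> with the
  full subcategory of the slice of \<open>C\<close> over \<open>c\<close> on the arrows whose domain lies in the image of \<open>L\<close>
  (lemma \<open>slice_transpose_full_faithful\<close>). Under this identification composition with \<open>U p\<close> is the
  restriction of composition with \<open>p\<close>. The pullback functor \<open>p\<^sup>*\<close> restricts as well, because the domain of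
  a pullback \<open>p\<^sup>* f\<close> maps to the domain of \<open>f\<close> and the subcategory is a sieve
  (lemma \<open>pullback_along_lies_in_image\<close>).

  What remains is a general fact about a monadic adjunction that restricts to full subcategories (theorem
  \<open>monadic_adjunction_restricts\<close>). The restricted comparison functor is fully faithful because the original
  one is. An algebra for the restricted monad is an algebra for the original one, hence isomorphic
  to the canonical algebra on \<open>p\<^sup>* y\<close> for some \<open>y\<close>; but only \<open>p\<^sup>* y\<close>, not \<open>y\<close> itself, is known to lie in the
  subcategory. Here the monic coreflection \<open>m\<close> of \<open>y\<close>, given by the counit (lemma
  \<open>slice_coreflection\<close>), helps: the arrow \<open>p\<^sub>! (p\<^sup>* y) \<rightarrow> y\<close> starts in the subcategory, so it factors through \<open>m\<close>,
  and the transpose of the factorization is a section of \<open>p\<^sup>* m\<close>. As \<open>p\<^sup>* m\<close> is also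
  monic, it is invertible, and the coreflection of \<open>y\<close> can replace \<open>y\<close>.

  No choice of pullbacks has to be tracked: any right adjoint of \<open>p\<^sub>!\<close> computes pullbacks along \<open>p\<close>, so effective
  descent is just monadicity of some such adjunction (lemma \<open>effective_descent_iff\<close>).
\<close>

section \<open>Arrows and functors\<close>

text \<open>The rules below speak of \<open>Arr\<close>, \<open>Dom\<close> and \<open>Cod\<close> instead of hom-sets because then every variable of a
  premise occurs in the conclusion. As rewrite rules they nest composites to the right and
  settle composability on the way.\<close>

context category
begin

lemma Comp_arr [simp]:
  assumes "f \<in> Arr C" "g \<in> Arr C" "Cod C f = Dom C g"
  shows "g \<cdot> f \<in> Arr C" "Dom C (g \<cdot> f) = Dom C f" "Cod C (g \<cdot> f) = Cod C g"
  using Comp_hom[of f "Dom C f" "Cod C f" g "Cod C g"] assms by (auto simp: hom_def)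

lemma Ident_arr [simp]:
  assumes "x \<in> Obj C"
  shows "Ident C x \<in> Arr C" "Dom C (Ident C x) = x" "Cod C (Ident C x) = x"
  using Ident_hom[OF assms] by (auto simp: hom_def)

lemma Comp_Ident_arr [simp]:
  assumes "f \<in> Arr C"
  shows "Cod C f = y \<Longrightarrow> Ident C y \<cdot> f = f" "Dom C f = x \<Longrightarrow> f \<cdot> Ident C x = f"
  using assms Comp_Ident_left[of f] Comp_Ident_right[of f] by (auto simp: hom_def)

lemma Comp_assoc_arr [simp]:
  assumes "f \<in> Arr C" "g \<in> Arr C" "h \<in> Arr C" "Cod C f = Dom C g" "Cod C g = Dom C h"
  shows "(h \<cdot> g) \<cdot> f = h \<cdot> (g \<cdot> f)"
  using Comp_assoc[of f "Dom C f" "Cod C f" g "Cod C g" h "Cod C h"] assms by (auto simp: hom_def)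

lemma Dom_Cod_Obj [simp]:
  assumes "f \<in> Arr C" shows "Dom C f \<in> Obj C" "Cod C f \<in> Obj C"
  using assms Dom_Obj Cod_Obj by auto

lemma homE:
  assumes "f \<in> hom C x y"
  shows "f \<in> Arr C" "Dom C f = x" "Cod C f = y" "x \<in> Obj C" "y \<in> Obj C"
  using assms Dom_Obj Cod_Obj by (auto simp: hom_def)

lemma is_isoI:
  assumes "f \<in> hom C x y" "g \<in> hom C y x" "g \<cdot> f = Ident C x" "f \<cdot> g = Ident C y"
  shows "is_iso C f"
  using assms by (auto simp: is_iso_def hom_def)

lemma is_isoE:
  assumes "is_iso C f" "f \<in> hom C x y"
  obtains g where "g \<in> hom C y x" "g \<cdot> f = Ident C x" "f \<cdot> g = Ident C y"
  using assms unfolding is_iso_def hom_def by auto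

lemma is_iso_cancel_left:
  assumes "is_iso C i" "i \<in> hom C y z" "f \<in> hom C x y" "g \<in> hom C x y" "i \<cdot> f = i \<cdot> g"
  shows "f = g"
proof -
  obtain j where j: "j \<in> hom C z y" "j \<cdot> i = Ident C y" using is_isoE[OF assms(1,2)] .
  have "(j \<cdot> i) \<cdot> f = (j \<cdot> i) \<cdot> g"
    using Comp_assoc[OF assms(3,2) j(1)] Comp_assoc[OF assms(4,2) j(1)] assms(5) by simp
  then show ?thesis using j(2) Comp_Ident_left[OF assms(3)] Comp_Ident_left[OF assms(4)] by simp
qed

lemma is_iso_cancel_right:
  assumes "is_iso C i" "i \<in> hom C x y" "f \<in> hom C y z" "g \<in> hom C y z" "f \<cdot> i = g \<cdot> i"
  shows "f = g"
proof -
  obtain j where j: "j \<in> hom C y x" "i \<cdot> j = Ident C y" using is_isoE[OF assms(1,2)] .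
  have "f \<cdot> (i \<cdot> j) = g \<cdot> (i \<cdot> j)"
    using Comp_assoc[OF j(1) assms(2,3)] Comp_assoc[OF j(1) assms(2,4)] assms(5) by simp
  then show ?thesis using j(2) Comp_Ident_right[OF assms(3)] Comp_Ident_right[OF assms(4)] by simp
qed

lemma is_iso_Comp:
  assumes f: "is_iso C f" "f \<in> hom C x y" and g: "is_iso C g" "g \<in> hom C y z"
  shows "is_iso C (g \<cdot> f)"
proof -
  obtain f' where f': "f' \<in> hom C y x" "f' \<cdot> f = Ident C x" "f \<cdot> f' = Ident C y"
    using is_isoE[OF f] .
  obtain g' where g': "g' \<in> hom C z y" "g' \<cdot> g = Ident C y" "g \<cdot> g' = Ident C z"
    using is_isoE[OF g] .
  note t = homE[OF f(2)] homE[OF g(2)] homE[OF f'(1)] homE[OF g'(1)]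
  have "g' \<cdot> g \<cdot> f = (g' \<cdot> g) \<cdot> f" "f \<cdot> f' \<cdot> g' = (f \<cdot> f') \<cdot> g'"
    using t by simp_all
  then have "g' \<cdot> g \<cdot> f = f" "f \<cdot> f' \<cdot> g' = g'" using t f' g' by simp_all
  then show ?thesis
    using t f' g' by (intro is_isoI[of _ x z "f' \<cdot> g'"]) (auto simp: hom_def)
qed

lemma is_iso_inverse:
  assumes "g \<cdot> f = Ident C x" "f \<cdot> g = Ident C y" "f \<in> hom C x y" "g \<in> hom C y x"
  shows "is_iso C g"
  using assms by (intro is_isoI[of g y x f])

lemma is_monicD:
  assumes "is_monic C m" "m \<in> hom C y z" "f \<in> hom C x y" "g \<in> hom C x y" "m \<cdot> f = m \<cdot> g"
  shows "f = g"
  using assms homE[OF assms(3)] homE(2)[OF assms(2)] unfolding is_monic_def by auto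

lemma monic_split_epi_is_iso:
  assumes m: "is_monic C m" "m \<in> hom C x y" and s: "s \<in> hom C y x" "m \<cdot> s = Ident C y"
  shows "is_iso C m"
proof -
  note t = homE[OF m(2)] homE[OF s(1)]
  have "m \<cdot> (s \<cdot> m) = (m \<cdot> s) \<cdot> m" using t by simp
  then have "m \<cdot> (s \<cdot> m) = m \<cdot> Ident C x" using t s by simp
  then have "s \<cdot> m = Ident C x"
    by (rule is_monicD[OF m Comp_hom[OF m(2) s(1)] Ident_hom[OF t(4)]])
  then show ?thesis using is_isoI[OF m(2) s(1)] s(2) by simp
qed

end

context is_functor
begin

lemma ArrMap_arr [simp]:
  assumes "f \<in> Arr A"
  shows "ArrMap F f \<in> Arr B" "Dom B (ArrMap F f) = ObjMap F (Dom A f)"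
    "Cod B (ArrMap F f) = ObjMap F (Cod A f)"
  using ArrMap_hom[of f "Dom A f" "Cod A f"] assms by (auto simp: hom_def)

lemma ObjMap_in_Obj [simp]: "x \<in> Obj A \<Longrightarrow> ObjMap F x \<in> Obj B"
  by (rule ObjMap_Obj)

lemma ArrMap_Ident_arr [simp]: "x \<in> Obj A \<Longrightarrow> ArrMap F (Ident A x) = Ident B (ObjMap F x)"
  by (rule ArrMap_Ident)

lemma ArrMap_Comp_arr [simp]:
  assumes "f \<in> Arr A" "g \<in> Arr A" "Cod A f = Dom A g"
  shows "ArrMap F (g \<cdot>\<^bsub>A\<^esub> f) = ArrMap F g \<cdot>\<^bsub>B\<^esub> ArrMap F f"
  using ArrMap_Comp[of f "Dom A f" "Cod A f" g "Cod A g"] assms by (auto simp: hom_def)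

lemma preserves_iso:
  assumes "is_iso A f" shows "is_iso B (ArrMap F f)"
proof -
  have f: "f \<in> hom A (Dom A f) (Cod A f)" using assms by (simp add: is_iso_def hom_def)
  obtain g where g: "g \<in> hom A (Cod A f) (Dom A f)"
      "g \<cdot>\<^bsub>A\<^esub> f = Ident A (Dom A f)" "f \<cdot>\<^bsub>A\<^esub> g = Ident A (Cod A f)"
    using A.is_isoE[OF assms f] .
  have "ArrMap F g \<cdot>\<^bsub>B\<^esub> ArrMap F f = Ident B (ObjMap F (Dom A f))"
    "ArrMap F f \<cdot>\<^bsub>B\<^esub> ArrMap F g = Ident B (ObjMap F (Cod A f))"
    using ArrMap_Comp[OF f g(1)] ArrMap_Comp[OF g(1) f] g A.homE[OF f] by simp_all
  then show ?thesis by (rule B.is_isoI[OF ArrMap_hom[OF f] ArrMap_hom[OF g(1)]])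
qed

end

lemma comp_id_func_simps [simp]:
  "ObjMap (G \<circ>\<^sub>F F) x = ObjMap G (ObjMap F x)" "ArrMap (G \<circ>\<^sub>F F) f = ArrMap G (ArrMap F f)"
  "ObjMap id_func y = y" "ArrMap id_func g = g"
  by (simp_all add: comp_func_def id_func_def)

lemma id_is_functor: "category A \<Longrightarrow> is_functor A A id_func"
  by (intro is_functor.intro is_functor_axioms.intro) auto

lemma comp_is_functor:
  assumes "is_functor A B F" "is_functor B D G" shows "is_functor A D (G \<circ>\<^sub>F F)"
proof -
  interpret F: is_functor A B F by fact
  interpret G: is_functor B D G by fact
  show ?thesis by unfold_locales (auto intro: F.ArrMap_hom G.ArrMap_hom simp: hom_def)
qed

lemma full_faithful_faithful:
  assumes "full_faithful A B F" "f \<in> hom A x y" "g \<in> hom A x y" "ArrMap F f = ArrMap F g"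
  shows "f = g"
proof -
  interpret is_functor A B F using assms(1) by (simp add: full_faithful_def)
  have "inj_on (ArrMap F) (hom A x y)"
    using assms(1) A.homE[OF assms(2)] by (auto simp: full_faithful_def bij_betw_def)
  then show ?thesis by (rule inj_onD[OF _ assms(4,2,3)])
qed

lemma full_faithful_full:
  assumes "full_faithful A B F" "x \<in> Obj A" "y \<in> Obj A" "k \<in> hom B (ObjMap F x) (ObjMap F y)"
  obtains f where "f \<in> hom A x y" "ArrMap F f = k"
proof -
  have "k \<in> ArrMap F ` hom A x y"
    using assms(1-4) by (auto simp: full_faithful_def bij_betw_def)
  then show ?thesis using that by blast
qed

lemma full_faithful_reflects_iso:
  assumes ff: "full_faithful A B F" and f: "f \<in> hom A x y" and iso: "is_iso B (ArrMap F f)"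
  shows "is_iso A f"
proof -
  interpret is_functor A B F using ff by (simp add: full_faithful_def)
  note t = A.homE[OF f]
  obtain k where k: "k \<in> hom B (ObjMap F y) (ObjMap F x)"
      "k \<cdot>\<^bsub>B\<^esub> ArrMap F f = Ident B (ObjMap F x)" "ArrMap F f \<cdot>\<^bsub>B\<^esub> k = Ident B (ObjMap F y)"
    using B.is_isoE[OF iso ArrMap_hom[OF f]] .
  obtain g where g: "g \<in> hom A y x" "ArrMap F g = k"
    using full_faithful_full[OF ff t(5,4) k(1)] .
  have "ArrMap F (g \<cdot>\<^bsub>A\<^esub> f) = ArrMap F (Ident A x)" "ArrMap F (f \<cdot>\<^bsub>A\<^esub> g) = ArrMap F (Ident A y)"
    using k g t A.homE[OF g(1)] by auto
  then have "g \<cdot>\<^bsub>A\<^esub> f = Ident A x" "f \<cdot>\<^bsub>A\<^esub> g = Ident A y"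
    using t A.Comp_hom[OF f g(1)] A.Comp_hom[OF g(1) f] A.Ident_hom
    by (blast intro: full_faithful_faithful[OF ff])+
  then show ?thesis by (rule A.is_isoI[OF f g(1)])
qed


section \<open>Adjunctions from universal arrows\<close>

context adjunction
begin

lemma counit_hom: "y \<in> Obj B \<Longrightarrow> \<epsilon> y \<in> hom B (ObjMap F (ObjMap G y)) y"
  using counit.component_hom[of y] by simp

lemma unit_hom: "x \<in> Obj A \<Longrightarrow> \<eta> x \<in> hom A x (ObjMap G (ObjMap F x))"
  using unit.component_hom[of x] by simp

lemma counit_arr [simp]:
  assumes "y \<in> Obj B"
  shows "\<epsilon> y \<in> Arr B" "Dom B (\<epsilon> y) = ObjMap F (ObjMap G y)" "Cod B (\<epsilon> y) = y"
  using F.B.homE[OF counit_hom[OF assms]] by auto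

lemma unit_arr [simp]:
  assumes "x \<in> Obj A"
  shows "\<eta> x \<in> Arr A" "Dom A (\<eta> x) = x" "Cod A (\<eta> x) = ObjMap G (ObjMap F x)"
  using F.A.homE[OF unit_hom[OF assms]] by auto

lemma counit_natural: "f \<in> hom B x y \<Longrightarrow> \<epsilon> y \<cdot>\<^bsub>B\<^esub> ArrMap F (ArrMap G f) = f \<cdot>\<^bsub>B\<^esub> \<epsilon> x"
  using counit.naturality[of f x y] by simp

lemma unit_natural: "f \<in> hom A x y \<Longrightarrow> ArrMap G (ArrMap F f) \<cdot>\<^bsub>A\<^esub> \<eta> x = \<eta> y \<cdot>\<^bsub>A\<^esub> f"
  using unit.naturality[of f x y] by simp

lemma transpose_hom:
  assumes "x \<in> Obj A" "f \<in> hom B (ObjMap F x) y"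
  shows "ArrMap G f \<cdot>\<^bsub>A\<^esub> \<eta> x \<in> hom A x (ObjMap G y)"
  using assms F.B.homE[OF assms(2)] by (auto simp: hom_def)

lemma counit_transpose:
  assumes x: "x \<in> Obj A" and f: "f \<in> hom B (ObjMap F x) y"
  shows "\<epsilon> y \<cdot>\<^bsub>B\<^esub> ArrMap F (ArrMap G f \<cdot>\<^bsub>A\<^esub> \<eta> x) = f"
proof -
  note t = F.B.homE[OF f]
  have "\<epsilon> y \<cdot>\<^bsub>B\<^esub> ArrMap F (ArrMap G f \<cdot>\<^bsub>A\<^esub> \<eta> x)
      = (\<epsilon> y \<cdot>\<^bsub>B\<^esub> ArrMap F (ArrMap G f)) \<cdot>\<^bsub>B\<^esub> ArrMap F (\<eta> x)"
    using x t by simp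
  also have "\<dots> = f \<cdot>\<^bsub>B\<^esub> (\<epsilon> (ObjMap F x) \<cdot>\<^bsub>B\<^esub> ArrMap F (\<eta> x))"
    using x t by (simp add: counit_natural[OF f])
  finally show ?thesis using x t triangle_left[OF x] by simp
qed

lemma transpose_counit:
  assumes y: "y \<in> Obj B" and g: "g \<in> hom A x (ObjMap G y)"
  shows "ArrMap G (\<epsilon> y \<cdot>\<^bsub>B\<^esub> ArrMap F g) \<cdot>\<^bsub>A\<^esub> \<eta> x = g"
proof -
  note t = F.A.homE[OF g]
  have "ArrMap G (\<epsilon> y \<cdot>\<^bsub>B\<^esub> ArrMap F g) \<cdot>\<^bsub>A\<^esub> \<eta> x
      = ArrMap G (\<epsilon> y) \<cdot>\<^bsub>A\<^esub> (ArrMap G (ArrMap F g) \<cdot>\<^bsub>A\<^esub> \<eta> x)"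
    using y t by simp
  also have "\<dots> = (ArrMap G (\<epsilon> y) \<cdot>\<^bsub>A\<^esub> \<eta> (ObjMap G y)) \<cdot>\<^bsub>A\<^esub> g"
    using y t by (simp add: unit_natural[OF g])
  finally show ?thesis using y t triangle_right[OF y] by simp
qed

lemma counit_cancel:
  assumes "y \<in> Obj B" "g \<in> hom A x (ObjMap G y)" "h \<in> hom A x (ObjMap G y)"
    "\<epsilon> y \<cdot>\<^bsub>B\<^esub> ArrMap F g = \<epsilon> y \<cdot>\<^bsub>B\<^esub> ArrMap F h"
  shows "g = h"
  using transpose_counit[OF assms(1,2)] unfolding assms(4) transpose_counit[OF assms(1,3)] ..

text \<open>Transposition turns composition with \<open>G m\<close> into composition with \<open>m\<close>.\<close>

lemma right_adjoint_preserves_monic: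
  assumes m: "is_monic B m" and h: "h \<in> hom A x (ObjMap G (Dom B m))"
    and k: "k \<in> hom A x (ObjMap G (Dom B m))"
    and eq: "ArrMap G m \<cdot>\<^bsub>A\<^esub> h = ArrMap G m \<cdot>\<^bsub>A\<^esub> k"
  shows "h = k"
proof -
  have mh: "m \<in> hom B (Dom B m) (Cod B m)" using m by (simp add: is_monic_def hom_def)
  note t = F.B.homE[OF mh] F.A.homE[OF h] F.A.homE[OF k]
  have "m \<cdot>\<^bsub>B\<^esub> (\<epsilon> (Dom B m) \<cdot>\<^bsub>B\<^esub> ArrMap F g) = \<epsilon> (Cod B m) \<cdot>\<^bsub>B\<^esub> ArrMap F (ArrMap G m \<cdot>\<^bsub>A\<^esub> g)"
    if g: "g \<in> hom A x (ObjMap G (Dom B m))" for g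
  proof -
    have "m \<cdot>\<^bsub>B\<^esub> (\<epsilon> (Dom B m) \<cdot>\<^bsub>B\<^esub> ArrMap F g) = (m \<cdot>\<^bsub>B\<^esub> \<epsilon> (Dom B m)) \<cdot>\<^bsub>B\<^esub> ArrMap F g"
      using t F.A.homE[OF g] by simp
    then show ?thesis using t F.A.homE[OF g] by (simp flip: counit_natural[OF mh])
  qed
  from this[OF h] this[OF k]
  have eq': "m \<cdot>\<^bsub>B\<^esub> (\<epsilon> (Dom B m) \<cdot>\<^bsub>B\<^esub> ArrMap F h) = m \<cdot>\<^bsub>B\<^esub> (\<epsilon> (Dom B m) \<cdot>\<^bsub>B\<^esub> ArrMap F k)"
    unfolding eq by simp
  have "\<epsilon> (Dom B m) \<cdot>\<^bsub>B\<^esub> ArrMap F h = \<epsilon> (Dom B m) \<cdot>\<^bsub>B\<^esub> ArrMap F k"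
    using t by (intro F.B.is_monicD[OF m mh _ _ eq', of "ObjMap F x"]) (simp_all add: hom_def)
  then show ?thesis using counit_cancel[OF _ h k] t by simp
qed

end

text \<open>The action of the right adjoint on \<open>f\<close> must be the factorization of \<open>f \<cdot> e x\<close> through the universal arrow, and
  the unit must be the factorization of an identity. Functoriality, naturality and the second triangle
  identity then hold because both sides have the same composite with a universal arrow.\<close>

lemma adjunction_from_universal_arrows:
  assumes F: "is_functor A B F"
    and obj: "\<And>y. y \<in> Obj B \<Longrightarrow> G0 y \<in> Obj A"
    and e: "\<And>y. y \<in> Obj B \<Longrightarrow> e y \<in> hom B (ObjMap F (G0 y)) y"
    and univ: "\<And>x y f. \<lbrakk>x \<in> Obj A; y \<in> Obj B; f \<in> hom B (ObjMap F x) y\<rbrakk> \<Longrightarrow>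
      \<exists>!g. g \<in> hom A x (G0 y) \<and> e y \<cdot>\<^bsub>B\<^esub> ArrMap F g = f"
  obtains G \<eta> where "adjunction A B F G \<eta> e" "ObjMap G = G0"
proof -
  interpret F: is_functor A B F by fact
  define ex where "ex x y f = (THE g. g \<in> hom A x (G0 y) \<and> e y \<cdot>\<^bsub>B\<^esub> ArrMap F g = f)" for x y f
  have ex: "ex x y f \<in> hom A x (G0 y)" "e y \<cdot>\<^bsub>B\<^esub> ArrMap F (ex x y f) = f"
    if "x \<in> Obj A" "y \<in> Obj B" "f \<in> hom B (ObjMap F x) y" for x y f
    using theI'[OF univ[OF that]] unfolding ex_def by blast+
  have uniq: "g = h" if "y \<in> Obj B" "g \<in> hom A x (G0 y)" "h \<in> hom A x (G0 y)"
      "e y \<cdot>\<^bsub>B\<^esub> ArrMap F g = e y \<cdot>\<^bsub>B\<^esub> ArrMap F h" for x y g h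
    using univ[OF F.A.homE(4)[OF that(2)] that(1)
          F.B.Comp_hom[OF F.ArrMap_hom[OF that(2)] e[OF that(1)]]] that(2-4) by metis
  have e_arr [simp]: "e y \<in> Arr B" "Dom B (e y) = ObjMap F (G0 y)" "Cod B (e y) = y"
    if "y \<in> Obj B" for y
    using F.B.homE[OF e[OF that]] by auto
  note [simp] = obj
  define G where "G = \<lparr>ObjMap = G0,
    ArrMap = \<lambda>f. ex (G0 (Dom B f)) (Cod B f) (f \<cdot>\<^bsub>B\<^esub> e (Dom B f))\<rparr>"
  define \<eta> where "\<eta> x = ex x (ObjMap F x) (Ident B (ObjMap F x))" for x
  have GO [simp]: "ObjMap G = G0" by (simp add: G_def)
  have G: "ArrMap G f \<in> hom A (G0 x) (G0 y)" "e y \<cdot>\<^bsub>B\<^esub> ArrMap F (ArrMap G f) = f \<cdot>\<^bsub>B\<^esub> e x"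
    if "f \<in> hom B x y" for f x y
    using ex[of "G0 x" y "f \<cdot>\<^bsub>B\<^esub> e x"] that F.B.homE[OF that] by (auto simp: G_def hom_def)
  have G_arr [simp]: "ArrMap G f \<in> Arr A" "Dom A (ArrMap G f) = G0 (Dom B f)"
      "Cod A (ArrMap G f) = G0 (Cod B f)" if "f \<in> Arr B" for f
    using F.A.homE[OF G(1)[of f "Dom B f" "Cod B f"]] that by (auto simp: hom_def)
  have \<eta>: "\<eta> x \<in> hom A x (G0 (ObjMap F x))"
      "e (ObjMap F x) \<cdot>\<^bsub>B\<^esub> ArrMap F (\<eta> x) = Ident B (ObjMap F x)" if "x \<in> Obj A" for x
    using ex[of x "ObjMap F x" "Ident B (ObjMap F x)"] that F.B.Ident_hom
    unfolding \<eta>_def by auto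
  have \<eta>_arr [simp]: "\<eta> x \<in> Arr A" "Dom A (\<eta> x) = x" "Cod A (\<eta> x) = G0 (ObjMap F x)"
    if "x \<in> Obj A" for x
    using F.A.homE[OF \<eta>(1)[OF that]] by auto
  have G_fun: "is_functor B A G"
  proof
    show "ArrMap G (Ident B x) = Ident A (ObjMap G x)" if "x \<in> Obj B" for x
      using G[OF F.B.Ident_hom[OF that]] that F.A.Ident_hom
      by (intro uniq[OF that, of _ "G0 x"]) auto
  next
    fix f x y g z assume f: "f \<in> hom B x y" and g: "g \<in> hom B y z"
    note t = F.B.homE[OF f] F.B.homE[OF g]
    have "e z \<cdot>\<^bsub>B\<^esub> ArrMap F (ArrMap G g \<cdot>\<^bsub>A\<^esub> ArrMap G f)
        = (e z \<cdot>\<^bsub>B\<^esub> ArrMap F (ArrMap G g)) \<cdot>\<^bsub>B\<^esub> ArrMap F (ArrMap G f)"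
      using t by simp
    also have "\<dots> = g \<cdot>\<^bsub>B\<^esub> (e y \<cdot>\<^bsub>B\<^esub> ArrMap F (ArrMap G f))"
      using t by (simp add: G(2)[OF g])
    also have "\<dots> = (g \<cdot>\<^bsub>B\<^esub> f) \<cdot>\<^bsub>B\<^esub> e x" using t by (simp add: G(2)[OF f])
    also have "\<dots> = e z \<cdot>\<^bsub>B\<^esub> ArrMap F (ArrMap G (g \<cdot>\<^bsub>B\<^esub> f))"
      by (rule G(2)[OF F.B.Comp_hom[OF f g], symmetric])
    finally have eq: "e z \<cdot>\<^bsub>B\<^esub> ArrMap F (ArrMap G (g \<cdot>\<^bsub>B\<^esub> f))
        = e z \<cdot>\<^bsub>B\<^esub> ArrMap F (ArrMap G g \<cdot>\<^bsub>A\<^esub> ArrMap G f)" ..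
    show "ArrMap G (g \<cdot>\<^bsub>B\<^esub> f) = ArrMap G g \<cdot>\<^bsub>A\<^esub> ArrMap G f"
      by (rule uniq[OF _ _ _ eq, of "G0 x"]) (use t in \<open>simp_all add: hom_def\<close>)
  qed (use G in auto)
  interpret G: is_functor B A G by (rule G_fun)
  have "adjunction A B F G \<eta> e"
  proof (intro adjunction.intro adjunction_axioms.intro nat_trans.intro nat_trans_axioms.intro
      id_is_functor comp_is_functor[OF F G_fun] comp_is_functor[OF G_fun F] F G_fun)
    fix f x y assume f: "f \<in> hom A x y"
    note t = F.A.homE[OF f]
    have "e (ObjMap F y) \<cdot>\<^bsub>B\<^esub> ArrMap F (ArrMap G (ArrMap F f) \<cdot>\<^bsub>A\<^esub> \<eta> x)
        = (e (ObjMap F y) \<cdot>\<^bsub>B\<^esub> ArrMap F (ArrMap G (ArrMap F f))) \<cdot>\<^bsub>B\<^esub> ArrMap F (\<eta> x)"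
      using t by simp
    also have "\<dots> = ArrMap F f \<cdot>\<^bsub>B\<^esub> (e (ObjMap F x) \<cdot>\<^bsub>B\<^esub> ArrMap F (\<eta> x))"
      using t by (simp add: G(2)[OF F.ArrMap_hom[OF f]])
    also have "\<dots> = (e (ObjMap F y) \<cdot>\<^bsub>B\<^esub> ArrMap F (\<eta> y)) \<cdot>\<^bsub>B\<^esub> ArrMap F f"
      using t by (simp add: \<eta>(2) del: F.B.Comp_assoc_arr)
    also have "\<dots> = e (ObjMap F y) \<cdot>\<^bsub>B\<^esub> ArrMap F (\<eta> y \<cdot>\<^bsub>A\<^esub> f)"
      using t by simp
    finally have "ArrMap G (ArrMap F f) \<cdot>\<^bsub>A\<^esub> \<eta> x = \<eta> y \<cdot>\<^bsub>A\<^esub> f"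
      by (rule uniq[of "ObjMap F y" _ x, rotated 3]) (use t in \<open>simp_all add: hom_def\<close>)
    then show "ArrMap (G \<circ>\<^sub>F F) f \<cdot>\<^bsub>A\<^esub> \<eta> x = \<eta> y \<cdot>\<^bsub>A\<^esub> ArrMap id_func f" by simp
  next
    fix y assume y: "y \<in> Obj B"
    have "e y \<cdot>\<^bsub>B\<^esub> ArrMap F (ArrMap G (e y) \<cdot>\<^bsub>A\<^esub> \<eta> (G0 y))
        = (e y \<cdot>\<^bsub>B\<^esub> ArrMap F (ArrMap G (e y))) \<cdot>\<^bsub>B\<^esub> ArrMap F (\<eta> (G0 y))"
      using y by simp
    also have "\<dots> = e y \<cdot>\<^bsub>B\<^esub> (e (ObjMap F (G0 y)) \<cdot>\<^bsub>B\<^esub> ArrMap F (\<eta> (G0 y)))"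
      using y by (simp add: G(2)[OF e[OF y]])
    also have "\<dots> = e y \<cdot>\<^bsub>B\<^esub> ArrMap F (Ident A (G0 y))"
      using y by (simp add: \<eta>(2))
    finally have "ArrMap G (e y) \<cdot>\<^bsub>A\<^esub> \<eta> (G0 y) = Ident A (G0 y)"
      by (rule uniq[of y _ "G0 y", rotated 3]) (use y in \<open>simp_all add: hom_def\<close>)
    then show "ArrMap G (e y) \<cdot>\<^bsub>A\<^esub> \<eta> (ObjMap G y) = Ident A (ObjMap G y)" by simp
  qed (use \<eta> G e F.A.category_axioms F.B.category_axioms in auto)
  then show thesis using GO by (rule that)
qed


section \<open>Equivalences and monadicity\<close>

text \<open>The isomorphism \<open>s\<close> makes \<open>F\<close> faithful and \<open>t\<close> makes \<open>G\<close> faithful. A preimage of \<open>k\<close> is \<open>G k\<close>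
  conjugated with \<open>s\<close>; that \<open>F\<close> maps it to \<open>k\<close> need only be checked after applying \<open>G\<close>.\<close>

lemma is_equivalence_full_faithful:
  assumes "is_equivalence A B F" shows "full_faithful A B F"
proof -
  obtain G s t where F: "is_functor A B F" and G: "is_functor B A G"
    and s: "nat_iso A A id_func (G \<circ>\<^sub>F F) s" and t: "nat_iso B B (F \<circ>\<^sub>F G) id_func t"
    using assms by (auto simp: is_equivalence_def)
  interpret F: is_functor A B F by (rule F)
  interpret G: is_functor B A G by (rule G)
  interpret s: nat_trans A A id_func "G \<circ>\<^sub>F F" s using s by (simp add: nat_iso_def)
  interpret t: nat_trans B B "F \<circ>\<^sub>F G" id_func t using t by (simp add: nat_iso_def)
  have s_iso: "is_iso A (s x)" "s x \<in> hom A x (ObjMap G (ObjMap F x))" if "x \<in> Obj A" for x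
    using s s.component_hom[OF that] that by (auto simp: nat_iso_def)
  have t_iso: "is_iso B (t y)" "t y \<in> hom B (ObjMap F (ObjMap G y)) y" if "y \<in> Obj B" for y
    using t t.component_hom[OF that] that by (auto simp: nat_iso_def)
  have F_faithful: "f = g"
    if f: "f \<in> hom A x y" and g: "g \<in> hom A x y" and eq: "ArrMap F f = ArrMap F g" for x y f g
    using s.naturality[OF f] s.naturality[OF g] eq F.A.homE(5)[OF f]
    by (intro F.A.is_iso_cancel_left[OF s_iso f g]) auto
  have G_faithful: "f = g"
    if f: "f \<in> hom B x y" and g: "g \<in> hom B x y" and eq: "ArrMap G f = ArrMap G g" for x y f g
    using t.naturality[OF f] t.naturality[OF g] eq F.B.homE(4)[OF f]
    by (intro F.B.is_iso_cancel_right[OF t_iso f g]) auto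
  have full: "\<exists>f\<in>hom A x y. ArrMap F f = k"
    if x: "x \<in> Obj A" and y: "y \<in> Obj A" and k: "k \<in> hom B (ObjMap F x) (ObjMap F y)" for x y k
  proof -
    obtain j where j: "j \<in> hom A (ObjMap G (ObjMap F y)) y" "j \<cdot>\<^bsub>A\<^esub> s y = Ident A y"
        "s y \<cdot>\<^bsub>A\<^esub> j = Ident A (ObjMap G (ObjMap F y))"
      using F.A.is_isoE[OF s_iso[OF y]] .
    define f where "f = j \<cdot>\<^bsub>A\<^esub> (ArrMap G k \<cdot>\<^bsub>A\<^esub> s x)"
    note c = F.A.homE[OF j(1)] F.A.homE[OF s_iso(2)[OF x]] F.A.homE[OF s_iso(2)[OF y]] F.B.homE[OF k]
    have f: "f \<in> hom A x y" using c unfolding f_def by (simp add: hom_def)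
    have "ArrMap G (ArrMap F f) \<cdot>\<^bsub>A\<^esub> s x = s y \<cdot>\<^bsub>A\<^esub> f"
      using s.naturality[OF f] by simp
    also have "\<dots> = (s y \<cdot>\<^bsub>A\<^esub> j) \<cdot>\<^bsub>A\<^esub> (ArrMap G k \<cdot>\<^bsub>A\<^esub> s x)"
      using c unfolding f_def by simp
    also have "\<dots> = ArrMap G k \<cdot>\<^bsub>A\<^esub> s x" using c j by simp
    finally have "ArrMap G (ArrMap F f) = ArrMap G k"
      by (rule F.A.is_iso_cancel_right[OF s_iso[OF x]
            G.ArrMap_hom[OF F.ArrMap_hom[OF f]] G.ArrMap_hom[OF k]])
    then have "ArrMap F f = k" by (rule G_faithful[OF F.ArrMap_hom[OF f] k])
    then show ?thesis using f by blast
  qed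
  show ?thesis
    unfolding full_faithful_def bij_betw_def
  proof (intro conjI ballI F inj_onI)
    show "ArrMap F ` hom A x y = hom B (ObjMap F x) (ObjMap F y)"
      if "x \<in> Obj A" "y \<in> Obj A" for x y
      using full[OF that] F.ArrMap_hom by blast
  qed (rule F_faithful)
qed

lemma is_equivalence_essentially_surjective:
  assumes "is_equivalence A B F" "y \<in> Obj B"
  obtains x i where "x \<in> Obj A" "i \<in> hom B y (ObjMap F x)" "is_iso B i"
proof -
  obtain G t where G: "is_functor B A G" and t: "nat_iso B B (F \<circ>\<^sub>F G) id_func t"
    using assms(1) by (auto simp: is_equivalence_def)
  interpret G: is_functor B A G by (rule G)
  interpret t: nat_trans B B "F \<circ>\<^sub>F G" id_func t using t by (simp add: nat_iso_def)
  have i: "is_iso B (t y)" "t y \<in> hom B (ObjMap F (ObjMap G y)) y"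
    using t t.component_hom[OF assms(2)] assms(2) by (auto simp: nat_iso_def)
  obtain j where "j \<in> hom B y (ObjMap F (ObjMap G y))"
      "j \<cdot>\<^bsub>B\<^esub> t y = Ident B (ObjMap F (ObjMap G y))" "t y \<cdot>\<^bsub>B\<^esub> j = Ident B y"
    using G.A.is_isoE[OF i] .
  then show ?thesis
    using assms(2) by (intro that[of "ObjMap G y" j] G.A.is_isoI[OF _ i(2)]) auto
qed

text \<open>Chosen isomorphisms \<open>F (G0 y) \<rightarrow> y\<close> are universal arrows, since \<open>F\<close> is fully faithful. They are the counit of
  an adjunction; its unit is invertible because \<open>F\<close> maps it, by a triangle identity, to the inverse of
  a counit component.\<close>

lemma is_equivalenceI:
  assumes ff: "full_faithful A B F"
    and ess: "\<And>y. y \<in> Obj B \<Longrightarrow> \<exists>x\<in>Obj A. \<exists>i\<in>hom B y (ObjMap F x). is_iso B i"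
  shows "is_equivalence A B F"
proof -
  interpret F: is_functor A B F using ff by (simp add: full_faithful_def)
  have "\<exists>x i. x \<in> Obj A \<and> i \<in> hom B (ObjMap F x) y \<and> is_iso B i" if y: "y \<in> Obj B" for y
  proof -
    obtain x i where i: "x \<in> Obj A" "i \<in> hom B y (ObjMap F x)" "is_iso B i" using ess[OF y] by blast
    obtain j where "j \<in> hom B (ObjMap F x) y"
        "j \<cdot>\<^bsub>B\<^esub> i = Ident B y" "i \<cdot>\<^bsub>B\<^esub> j = Ident B (ObjMap F x)"
      using F.B.is_isoE[OF i(3,2)] .
    then show ?thesis using i(1,2) F.B.is_isoI[of j "ObjMap F x" y i] by blast
  qed
  then obtain G0 t where G0: "\<And>y. y \<in> Obj B \<Longrightarrow> G0 y \<in> Obj A"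
    and t: "\<And>y. y \<in> Obj B \<Longrightarrow> t y \<in> hom B (ObjMap F (G0 y)) y" "\<And>y. y \<in> Obj B \<Longrightarrow> is_iso B (t y)"
    by metis
  have univ: "\<exists>!g. g \<in> hom A x (G0 y) \<and> t y \<cdot>\<^bsub>B\<^esub> ArrMap F g = f"
    if x: "x \<in> Obj A" and y: "y \<in> Obj B" and f: "f \<in> hom B (ObjMap F x) y" for x y f
  proof (rule ex_ex1I)
    obtain j where j: "j \<in> hom B y (ObjMap F (G0 y))"
        "j \<cdot>\<^bsub>B\<^esub> t y = Ident B (ObjMap F (G0 y))" "t y \<cdot>\<^bsub>B\<^esub> j = Ident B y"
      using F.B.is_isoE[OF t(2,1)[OF y]] .
    obtain g where g: "g \<in> hom A x (G0 y)" "ArrMap F g = j \<cdot>\<^bsub>B\<^esub> f"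
      using full_faithful_full[OF ff x G0[OF y] F.B.Comp_hom[OF f j(1)]] .
    have "t y \<cdot>\<^bsub>B\<^esub> (j \<cdot>\<^bsub>B\<^esub> f) = f"
      using F.B.Comp_assoc[OF f j(1) t(1)[OF y]] F.B.Comp_Ident_left[OF f] j(3) by simp
    then show "\<exists>g. g \<in> hom A x (G0 y) \<and> t y \<cdot>\<^bsub>B\<^esub> ArrMap F g = f" using g by auto
  next
    fix g h assume "g \<in> hom A x (G0 y) \<and> t y \<cdot>\<^bsub>B\<^esub> ArrMap F g = f"
      and "h \<in> hom A x (G0 y) \<and> t y \<cdot>\<^bsub>B\<^esub> ArrMap F h = f"
    then have gh: "g \<in> hom A x (G0 y)" "h \<in> hom A x (G0 y)"
      and eq: "t y \<cdot>\<^bsub>B\<^esub> ArrMap F g = t y \<cdot>\<^bsub>B\<^esub> ArrMap F h" by auto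
    show "g = h"
      by (rule full_faithful_faithful[OF ff gh F.B.is_iso_cancel_left[OF t(2,1)[OF y]
              F.ArrMap_hom[OF gh(1)] F.ArrMap_hom[OF gh(2)] eq]])
  qed
  obtain G \<eta> where adj: "adjunction A B F G \<eta> t" and G: "ObjMap G = G0"
    using adjunction_from_universal_arrows[OF F.is_functor_axioms G0 t(1) univ] .
  interpret adjunction A B F G \<eta> t by (rule adj)
  have "is_iso A (\<eta> x)" if x: "x \<in> Obj A" for x
  proof -
    have Fx: "ObjMap F x \<in> Obj B" using x by simp
    have h: "t (ObjMap F x) \<in> hom B (ObjMap F (ObjMap G (ObjMap F x))) (ObjMap F x)"
      by (rule counit_hom[OF Fx])
    obtain j where j: "j \<in> hom B (ObjMap F x) (ObjMap F (ObjMap G (ObjMap F x)))"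
        "j \<cdot>\<^bsub>B\<^esub> t (ObjMap F x) = Ident B (ObjMap F (ObjMap G (ObjMap F x)))"
        "t (ObjMap F x) \<cdot>\<^bsub>B\<^esub> j = Ident B (ObjMap F x)"
      using F.B.is_isoE[OF t(2)[OF Fx] h] .
    have "ArrMap F (\<eta> x) = j"
      using triangle_left[OF x] j(3)
      by (intro F.B.is_iso_cancel_left[OF t(2)[OF Fx] h F.ArrMap_hom[OF unit_hom[OF x]] j(1)]) simp
    then have "is_iso B (ArrMap F (\<eta> x))"
      using F.B.is_isoI[OF j(1) h j(3,2)] by simp
    then show ?thesis by (rule full_faithful_reflects_iso[OF ff unit_hom[OF x]])
  qed
  then have "nat_iso A A id_func (G \<circ>\<^sub>F F) \<eta>" "nat_iso B B (F \<circ>\<^sub>F G) id_func t"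
    using unit.nat_trans_axioms counit.nat_trans_axioms t(2) by (auto simp: nat_iso_def)
  then show ?thesis
    using F.is_functor_axioms G.is_functor_axioms unfolding is_equivalence_def by blast
qed

lemma EM_hom_iff:
  "m \<in> hom (EM_cat A T \<eta> \<mu>) (x, a) (y, b) \<longleftrightarrow>
    (\<exists>h. m = ((x, a), h, (y, b)) \<and> (x, a) \<in> algebras A T \<eta> \<mu> \<and> (y, b) \<in> algebras A T \<eta> \<mu> \<and>
      h \<in> hom A x y \<and> h \<cdot>\<^bsub>A\<^esub> a = b \<cdot>\<^bsub>A\<^esub> ArrMap T h)"
  by (auto simp: EM_cat_def hom_def)

text \<open>If \<open>k\<close> is inverse to \<open>h\<close>, then \<open>k b = k b T(h) T(k) = k h a T(k) = a T(k)\<close>, so \<open>k\<close> respects the structure maps.\<close>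

lemma EM_iso_iff:
  assumes T: "is_functor A A T"
    and m: "((x, a), h, (y, b)) \<in> hom (EM_cat A T \<eta> \<mu>) (x, a) (y, b)"
  shows "is_iso (EM_cat A T \<eta> \<mu>) ((x, a), h, (y, b)) \<longleftrightarrow> is_iso A h"
proof
  interpret T: is_functor A A T by (rule T)
  interpret E: category "EM_cat A T \<eta> \<mu>" by (rule EM_category[OF T])
  have alg: "(x, a) \<in> algebras A T \<eta> \<mu>" "(y, b) \<in> algebras A T \<eta> \<mu>"
    and h: "h \<in> hom A x y" "h \<cdot>\<^bsub>A\<^esub> a = b \<cdot>\<^bsub>A\<^esub> ArrMap T h"
    using m unfolding EM_hom_iff by auto
  have ab: "a \<in> hom A (ObjMap T x) x" "b \<in> hom A (ObjMap T y) y"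
    using alg by (auto simp: algebras_def)
  {
    assume "is_iso (EM_cat A T \<eta> \<mu>) ((x, a), h, (y, b))"
    then obtain k where "k \<in> hom (EM_cat A T \<eta> \<mu>) (y, b) (x, a)"
        "k \<cdot>\<^bsub>EM_cat A T \<eta> \<mu>\<^esub> ((x, a), h, (y, b)) = Ident (EM_cat A T \<eta> \<mu>) (x, a)"
        "((x, a), h, (y, b)) \<cdot>\<^bsub>EM_cat A T \<eta> \<mu>\<^esub> k = Ident (EM_cat A T \<eta> \<mu>) (y, b)"
      using m by (rule E.is_isoE)
    then show "is_iso A h"
      unfolding EM_hom_iff by (auto simp: EM_cat_def intro: T.A.is_isoI[OF h(1)])
  next
    assume iso: "is_iso A h"
    obtain k where k: "k \<in> hom A y x" "k \<cdot>\<^bsub>A\<^esub> h = Ident A x" "h \<cdot>\<^bsub>A\<^esub> k = Ident A y"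
      using T.A.is_isoE[OF iso h(1)] .
    note c = T.A.homE[OF k(1)] T.A.homE[OF h(1)] T.A.homE[OF ab(1)] T.A.homE[OF ab(2)]
    have Thk: "ArrMap T h \<cdot>\<^bsub>A\<^esub> ArrMap T k = Ident A (ObjMap T y)"
      using c k(3) T.ArrMap_Comp[OF k(1) h(1)] by simp
    have "k \<cdot>\<^bsub>A\<^esub> b = k \<cdot>\<^bsub>A\<^esub> (b \<cdot>\<^bsub>A\<^esub> (ArrMap T h \<cdot>\<^bsub>A\<^esub> ArrMap T k))"
      using c by (simp add: Thk)
    also have "\<dots> = k \<cdot>\<^bsub>A\<^esub> ((h \<cdot>\<^bsub>A\<^esub> a) \<cdot>\<^bsub>A\<^esub> ArrMap T k)"
      unfolding h(2) using c by simp
    also have "\<dots> = (k \<cdot>\<^bsub>A\<^esub> h) \<cdot>\<^bsub>A\<^esub> (a \<cdot>\<^bsub>A\<^esub> ArrMap T k)"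
      using c by (simp del: k)
    also have "\<dots> = a \<cdot>\<^bsub>A\<^esub> ArrMap T k" using c by (simp add: k)
    finally have "((y, b), k, (x, a)) \<in> hom (EM_cat A T \<eta> \<mu>) (y, b) (x, a)"
      using k alg unfolding EM_hom_iff by auto
    then show "is_iso (EM_cat A T \<eta> \<mu>) ((x, a), h, (y, b))"
      using k by (intro E.is_isoI[OF m]) (auto simp: EM_cat_def)
  }
qed

context adjunction
begin

abbreviation monad_algebras where
  "monad_algebras \<equiv> algebras A (G \<circ>\<^sub>F F) \<eta> (\<lambda>x. ArrMap G (\<epsilon> (ObjMap F x)))"

lemma monad_functor: "is_functor A A (G \<circ>\<^sub>F F)"
  by (rule comp_is_functor[OF F.is_functor_axioms G.is_functor_axioms])

lemma comparison_Obj: "y \<in> Obj B \<Longrightarrow> (ObjMap G y, ArrMap G (\<epsilon> y)) \<in> monad_algebras"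
  using is_functor.ObjMap_Obj[OF comparison_functor[OF adjunction_axioms], of y]
  by (simp add: comparison_def adj_EM_cat_def EM_cat_def Let_def)

lemma comparison_simps:
  "ObjMap (comparison B G \<epsilon>) y = (ObjMap G y, ArrMap G (\<epsilon> y))"
  "f \<in> hom B y z \<Longrightarrow> ArrMap (comparison B G \<epsilon>) f
    = ((ObjMap G y, ArrMap G (\<epsilon> y)), ArrMap G f, (ObjMap G z, ArrMap G (\<epsilon> z)))"
  by (auto simp: comparison_def Let_def hom_def)

text \<open>Monadicity in terms of \<open>G\<close> and \<open>\<epsilon>\<close> alone: the three conditions say that the comparison functor
  is faithful, full and essentially surjective. Later arguments can stay inside \<open>A\<close> and \<open>B\<close> and compose arrows
  of these categories instead of triples.\<close>

lemma monadic_adjunction_iff: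
  "monadic_adjunction A B F G \<eta> \<epsilon> \<longleftrightarrow>
    (\<forall>y z. \<forall>f\<in>hom B y z. \<forall>g\<in>hom B y z. ArrMap G f = ArrMap G g \<longrightarrow> f = g) \<and>
    (\<forall>y\<in>Obj B. \<forall>z\<in>Obj B. \<forall>h\<in>hom A (ObjMap G y) (ObjMap G z).
      h \<cdot>\<^bsub>A\<^esub> ArrMap G (\<epsilon> y) = ArrMap G (\<epsilon> z) \<cdot>\<^bsub>A\<^esub> ArrMap G (ArrMap F h) \<longrightarrow>
        (\<exists>f\<in>hom B y z. ArrMap G f = h)) \<and>
    (\<forall>x a. (x, a) \<in> monad_algebras \<longrightarrow>
      (\<exists>y\<in>Obj B. \<exists>h\<in>hom A x (ObjMap G y). is_iso A h \<and>
        h \<cdot>\<^bsub>A\<^esub> a = ArrMap G (\<epsilon> y) \<cdot>\<^bsub>A\<^esub> ArrMap G (ArrMap F h)))"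
    (is "_ \<longleftrightarrow> ?faithful \<and> ?full \<and> ?ess")
proof -
  let ?E = "adj_EM_cat A F G \<eta> \<epsilon>" and ?K = "comparison B G \<epsilon>"
  interpret K: is_functor B ?E ?K by (rule comparison_functor[OF adjunction_axioms])
  have hom_K: "m \<in> hom ?E (ObjMap ?K y) (ObjMap ?K z) \<longleftrightarrow>
      (\<exists>h\<in>hom A (ObjMap G y) (ObjMap G z). m = (ObjMap ?K y, h, ObjMap ?K z) \<and>
        h \<cdot>\<^bsub>A\<^esub> ArrMap G (\<epsilon> y) = ArrMap G (\<epsilon> z) \<cdot>\<^bsub>A\<^esub> ArrMap G (ArrMap F h))"
    if "y \<in> Obj B" "z \<in> Obj B" for m y z
    using comparison_Obj that unfolding adj_EM_cat_def comparison_simps(1) EM_hom_iff by auto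
  have ff: "full_faithful B ?E ?K \<longleftrightarrow> ?faithful \<and> ?full"
  proof
    assume ff: "full_faithful B ?E ?K"
    have ?faithful
      using full_faithful_faithful[OF ff] by (simp add: comparison_simps)
    moreover have "\<exists>f\<in>hom B y z. ArrMap G f = h"
      if yz: "y \<in> Obj B" "z \<in> Obj B" and h: "h \<in> hom A (ObjMap G y) (ObjMap G z)"
        "h \<cdot>\<^bsub>A\<^esub> ArrMap G (\<epsilon> y) = ArrMap G (\<epsilon> z) \<cdot>\<^bsub>A\<^esub> ArrMap G (ArrMap F h)" for y z h
    proof -
      obtain f where "f \<in> hom B y z" "ArrMap ?K f = (ObjMap ?K y, h, ObjMap ?K z)"
        using full_faithful_full[OF ff yz, of "(ObjMap ?K y, h, ObjMap ?K z)"]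
        unfolding hom_K[OF yz] using h by blast
      then show ?thesis by (auto simp: comparison_simps)
    qed
    ultimately show "?faithful \<and> ?full" by blast
  next
    assume *: "?faithful \<and> ?full"
    have "inj_on (ArrMap ?K) (hom B y z)" for y z
      using * by (intro inj_onI) (simp add: comparison_simps)
    moreover have "hom ?E (ObjMap ?K y) (ObjMap ?K z) \<subseteq> ArrMap ?K ` hom B y z"
      if yz: "y \<in> Obj B" "z \<in> Obj B" for y z
    proof
      fix m assume "m \<in> hom ?E (ObjMap ?K y) (ObjMap ?K z)"
      then obtain h where h: "h\<in>hom A (ObjMap G y) (ObjMap G z)" "m = (ObjMap ?K y, h, ObjMap ?K z)"
          "h \<cdot>\<^bsub>A\<^esub> ArrMap G (\<epsilon> y) = ArrMap G (\<epsilon> z) \<cdot>\<^bsub>A\<^esub> ArrMap G (ArrMap F h)"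
        unfolding hom_K[OF yz] by blast
      then obtain f where "f \<in> hom B y z" "ArrMap G f = h" using * yz by blast
      then show "m \<in> ArrMap ?K ` hom B y z"
        using h(2) by (intro image_eqI[of _ _ f]) (auto simp: comparison_simps)
    qed
    ultimately show "full_faithful B ?E ?K"
      using K.ArrMap_hom K.is_functor_axioms
      unfolding full_faithful_def bij_betw_def by blast
  qed
  have iso_K: "is_iso ?E ((x, a), h, ObjMap ?K y) \<longleftrightarrow> is_iso A h"
    if "((x, a), h, ObjMap ?K y) \<in> hom ?E (x, a) (ObjMap ?K y)" for x a h y
    using EM_iso_iff[OF monad_functor] that unfolding adj_EM_cat_def comparison_simps(1) by blast
  have hom_to_K: "m \<in> hom ?E (x, a) (ObjMap ?K y) \<longleftrightarrow>
      (\<exists>h\<in>hom A x (ObjMap G y). m = ((x, a), h, ObjMap ?K y) \<and>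
        h \<cdot>\<^bsub>A\<^esub> a = ArrMap G (\<epsilon> y) \<cdot>\<^bsub>A\<^esub> ArrMap G (ArrMap F h))"
    if "(x, a) \<in> monad_algebras" "y \<in> Obj B" for m x a y
    using comparison_Obj that unfolding adj_EM_cat_def comparison_simps(1) EM_hom_iff by auto
  have objE: "Obj ?E = monad_algebras" by (simp add: adj_EM_cat_def EM_cat_def)
  have ess: "(\<exists>y\<in>Obj B. \<exists>i\<in>hom ?E (x, a) (ObjMap ?K y). is_iso ?E i) \<longleftrightarrow>
      (\<exists>y\<in>Obj B. \<exists>h\<in>hom A x (ObjMap G y). is_iso A h \<and>
        h \<cdot>\<^bsub>A\<^esub> a = ArrMap G (\<epsilon> y) \<cdot>\<^bsub>A\<^esub> ArrMap G (ArrMap F h))" if "(x, a) \<in> monad_algebras" for x a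
  proof (rule bex_cong[OF refl])
    fix y assume y: "y \<in> Obj B"
    have "\<exists>i\<in>hom ?E (x, a) (ObjMap ?K y). is_iso ?E i"
      if h: "h\<in>hom A x (ObjMap G y)" "is_iso A h"
        "h \<cdot>\<^bsub>A\<^esub> a = ArrMap G (\<epsilon> y) \<cdot>\<^bsub>A\<^esub> ArrMap G (ArrMap F h)" for h
    proof -
      have "((x, a), h, ObjMap ?K y) \<in> hom ?E (x, a) (ObjMap ?K y)"
        unfolding hom_to_K[OF \<open>(x, a) \<in> monad_algebras\<close> y] using h by blast
      then show ?thesis using iso_K h(2) by blast
    qed
    moreover have "\<exists>h\<in>hom A x (ObjMap G y). is_iso A h \<and>
        h \<cdot>\<^bsub>A\<^esub> a = ArrMap G (\<epsilon> y) \<cdot>\<^bsub>A\<^esub> ArrMap G (ArrMap F h)"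
      if i: "i \<in> hom ?E (x, a) (ObjMap ?K y)" "is_iso ?E i" for i
    proof -
      obtain h where h: "h \<in> hom A x (ObjMap G y)" "i = ((x, a), h, ObjMap ?K y)"
          "h \<cdot>\<^bsub>A\<^esub> a = ArrMap G (\<epsilon> y) \<cdot>\<^bsub>A\<^esub> ArrMap G (ArrMap F h)"
        using i(1) unfolding hom_to_K[OF \<open>(x, a) \<in> monad_algebras\<close> y] by blast
      then show ?thesis using iso_K i by blast
    qed
    ultimately show "(\<exists>i\<in>hom ?E (x, a) (ObjMap ?K y). is_iso ?E i) \<longleftrightarrow>
        (\<exists>h\<in>hom A x (ObjMap G y). is_iso A h \<and>
          h \<cdot>\<^bsub>A\<^esub> a = ArrMap G (\<epsilon> y) \<cdot>\<^bsub>A\<^esub> ArrMap G (ArrMap F h))"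
      by blast
  qed
  show ?thesis
  proof
    assume "monadic_adjunction A B F G \<eta> \<epsilon>"
    then have eq: "is_equivalence B ?E ?K" by (simp add: monadic_adjunction_def)
    then have "?faithful \<and> ?full" using ff is_equivalence_full_faithful by blast
    moreover have ?ess
    proof (intro allI impI)
      fix x a assume alg: "(x, a) \<in> monad_algebras"
      then obtain y i where "y \<in> Obj B" "i \<in> hom ?E (x, a) (ObjMap ?K y)" "is_iso ?E i"
        using is_equivalence_essentially_surjective[OF eq, of "(x, a)"] unfolding objE by blast
      then show "\<exists>y\<in>Obj B. \<exists>h\<in>hom A x (ObjMap G y). is_iso A h \<and>
          h \<cdot>\<^bsub>A\<^esub> a = ArrMap G (\<epsilon> y) \<cdot>\<^bsub>A\<^esub> ArrMap G (ArrMap F h)"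
        using ess[OF alg] by blast
    qed
    ultimately show "?faithful \<and> ?full \<and> ?ess" by blast
  next
    assume *: "?faithful \<and> ?full \<and> ?ess"
    have "is_equivalence B ?E ?K"
    proof (rule is_equivalenceI)
      show "full_faithful B ?E ?K" using * ff by blast
      show "\<exists>x\<in>Obj B. \<exists>i\<in>hom ?E y (ObjMap ?K x). is_iso ?E i" if "y \<in> Obj ?E" for y
      proof -
        obtain x a where y: "y = (x, a)" by (cases y)
        then have "(x, a) \<in> monad_algebras" using that objE by blast
        then show ?thesis using * ess unfolding y by blast
      qed
    qed
    then show "monadic_adjunction A B F G \<eta> \<epsilon>"
      using adjunction_axioms by (simp add: monadic_adjunction_def)
  qed
qed

end

section \<open>Restricting a monadic adjunction to full subcategories\<close>

text \<open>The full subcategories are given by fully faithful functors \<open>I\<close> and \<open>J\<close>. The left adjoints commute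
  with them strictly, which holds in the application and keeps coherence isomorphisms out of the
  computations; the right adjoints will commute only up to an isomorphism.\<close>

locale adjunction_restriction =
  adjunction X Y F G \<eta> \<epsilon> + I: is_functor X' X I + J: is_functor Y' Y J + F': is_functor X' Y' F'
  for X :: "('o1, 'm1) cat" and Y :: "('o2, 'm2) cat" and F G \<eta> \<epsilon>
    and X' :: "('o3, 'm3) cat" and Y' :: "('o4, 'm4) cat" and I J F' +
  assumes I_ff: "full_faithful X' X I" and J_ff: "full_faithful Y' Y J"
    and square_Obj [simp]: "x \<in> Obj X' \<Longrightarrow> ObjMap J (ObjMap F' x) = ObjMap F (ObjMap I x)"
    and square_Arr [simp]: "f \<in> Arr X' \<Longrightarrow> ArrMap J (ArrMap F' f) = ArrMap F (ArrMap I f)"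
begin

text \<open>The transpose \<open>F (I (G0 y)) \<rightarrow> J y\<close> of \<open>\<theta> y\<close> is universal because \<open>\<theta> y\<close> is invertible. Its domain
  is \<open>J (F' (G0 y))\<close>, so it comes from an arrow of \<open>Y'\<close>, and fully faithful functors reflect the universal
  property.\<close>

lemma restricted_adjunction_exists:
  assumes G0: "\<And>y. y \<in> Obj Y' \<Longrightarrow> G0 y \<in> Obj X'"
    and \<theta>: "\<And>y. y \<in> Obj Y' \<Longrightarrow> \<theta> y \<in> hom X (ObjMap I (G0 y)) (ObjMap G (ObjMap J y))"
    and \<theta>_iso: "\<And>y. y \<in> Obj Y' \<Longrightarrow> is_iso X (\<theta> y)"
  obtains G' \<eta>' e where "adjunction X' Y' F' G' \<eta>' e" "ObjMap G' = G0"
    "\<And>y. y \<in> Obj Y' \<Longrightarrow> ArrMap J (e y) = \<epsilon> (ObjMap J y) \<cdot>\<^bsub>Y\<^esub> ArrMap F (\<theta> y)"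
proof -
  have \<theta>_arr [simp]: "\<theta> y \<in> Arr X" "Dom X (\<theta> y) = ObjMap I (G0 y)"
      "Cod X (\<theta> y) = ObjMap G (ObjMap J y)" if "y \<in> Obj Y'" for y
    using F.A.homE[OF \<theta>[OF that]] by auto
  have "\<exists>e. e \<in> hom Y' (ObjMap F' (G0 y)) y \<and> ArrMap J e = \<epsilon> (ObjMap J y) \<cdot>\<^bsub>Y\<^esub> ArrMap F (\<theta> y)"
    if y: "y \<in> Obj Y'" for y
  proof -
    have "\<epsilon> (ObjMap J y) \<cdot>\<^bsub>Y\<^esub> ArrMap F (\<theta> y) \<in> hom Y (ObjMap J (ObjMap F' (G0 y))) (ObjMap J y)"
      using y G0[OF y] by (simp add: hom_def)
    from full_faithful_full[OF J_ff _ y this] show ?thesis using y G0 by auto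
  qed
  then obtain e where e: "\<And>y. y \<in> Obj Y' \<Longrightarrow> e y \<in> hom Y' (ObjMap F' (G0 y)) y"
    and Je: "\<And>y. y \<in> Obj Y' \<Longrightarrow> ArrMap J (e y) = \<epsilon> (ObjMap J y) \<cdot>\<^bsub>Y\<^esub> ArrMap F (\<theta> y)"
    by metis
  have comp: "ArrMap J (e y \<cdot>\<^bsub>Y'\<^esub> ArrMap F' g)
      = \<epsilon> (ObjMap J y) \<cdot>\<^bsub>Y\<^esub> ArrMap F (\<theta> y \<cdot>\<^bsub>X\<^esub> ArrMap I g)"
    if y: "y \<in> Obj Y'" and g: "g \<in> hom X' x (G0 y)" for x y g
    using y I.A.homE[OF g] J.A.homE[OF e[OF y]] by (simp add: Je)
  have univ: "\<exists>!g. g \<in> hom X' x (G0 y) \<and> e y \<cdot>\<^bsub>Y'\<^esub> ArrMap F' g = f"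
    if x: "x \<in> Obj X'" and y: "y \<in> Obj Y'" and f: "f \<in> hom Y' (ObjMap F' x) y" for x y f
  proof (rule ex_ex1I)
    have Jf: "ArrMap J f \<in> hom Y (ObjMap F (ObjMap I x)) (ObjMap J y)"
      using J.ArrMap_hom[OF f] x by simp
    define k where "k = ArrMap G (ArrMap J f) \<cdot>\<^bsub>X\<^esub> \<eta> (ObjMap I x)"
    have k: "k \<in> hom X (ObjMap I x) (ObjMap G (ObjMap J y))"
      "\<epsilon> (ObjMap J y) \<cdot>\<^bsub>Y\<^esub> ArrMap F k = ArrMap J f"
      using transpose_hom[OF _ Jf] counit_transpose[OF _ Jf] x unfolding k_def by simp_all
    obtain t where t: "t \<in> hom X (ObjMap G (ObjMap J y)) (ObjMap I (G0 y))"
        "t \<cdot>\<^bsub>X\<^esub> \<theta> y = Ident X (ObjMap I (G0 y))" "\<theta> y \<cdot>\<^bsub>X\<^esub> t = Ident X (ObjMap G (ObjMap J y))"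
      using F.A.is_isoE[OF \<theta>_iso[OF y] \<theta>[OF y]] .
    obtain g where g: "g \<in> hom X' x (G0 y)" "ArrMap I g = t \<cdot>\<^bsub>X\<^esub> k"
      using full_faithful_full[OF I_ff x G0[OF y] F.A.Comp_hom[OF k(1) t(1)]] .
    have "\<theta> y \<cdot>\<^bsub>X\<^esub> (t \<cdot>\<^bsub>X\<^esub> k) = k"
      using F.A.Comp_assoc[OF k(1) t(1) \<theta>[OF y]] F.A.Comp_Ident_left[OF k(1)] t(3) by simp
    then have "ArrMap J (e y \<cdot>\<^bsub>Y'\<^esub> ArrMap F' g) = ArrMap J f"
      unfolding comp[OF y g(1)] g(2) using k(2) by simp
    then have "e y \<cdot>\<^bsub>Y'\<^esub> ArrMap F' g = f"
      by (rule full_faithful_faithful[OF J_ff J.A.Comp_hom[OF F'.ArrMap_hom[OF g(1)] e[OF y]] f])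
    then show "\<exists>g. g \<in> hom X' x (G0 y) \<and> e y \<cdot>\<^bsub>Y'\<^esub> ArrMap F' g = f" using g(1) by blast
  next
    fix g h assume "g \<in> hom X' x (G0 y) \<and> e y \<cdot>\<^bsub>Y'\<^esub> ArrMap F' g = f"
      and "h \<in> hom X' x (G0 y) \<and> e y \<cdot>\<^bsub>Y'\<^esub> ArrMap F' h = f"
    then have gh: "g \<in> hom X' x (G0 y)" "h \<in> hom X' x (G0 y)"
      and eq: "ArrMap J (e y \<cdot>\<^bsub>Y'\<^esub> ArrMap F' g) = ArrMap J (e y \<cdot>\<^bsub>Y'\<^esub> ArrMap F' h)" by auto
    note Igh = I.ArrMap_hom[OF gh(1)] I.ArrMap_hom[OF gh(2)]
    have "\<theta> y \<cdot>\<^bsub>X\<^esub> ArrMap I g = \<theta> y \<cdot>\<^bsub>X\<^esub> ArrMap I h"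
      using eq unfolding comp[OF y gh(1)] comp[OF y gh(2)]
      by (rule counit_cancel[OF J.ObjMap_Obj[OF y] F.A.Comp_hom[OF Igh(1) \<theta>[OF y]]
            F.A.Comp_hom[OF Igh(2) \<theta>[OF y]]])
    then show "g = h"
      by (rule full_faithful_faithful[OF I_ff gh F.A.is_iso_cancel_left[OF \<theta>_iso[OF y] \<theta>[OF y] Igh]])
  qed
  show thesis
    using adjunction_from_universal_arrows[OF F'.is_functor_axioms G0 e univ] that Je by metis
qed

end

text \<open>The assumption on the counits says that \<open>\<theta> y\<close> is the transpose of \<open>J (e y)\<close>; so \<open>\<theta>\<close> is the canonical
  comparison between \<open>I G'\<close> and \<open>G J\<close>, and its compatibility with all structure follows.\<close>

locale restricted_adjunction =
  adjunction_restriction X Y F G \<eta> \<epsilon> X' Y' I J F' + restr: adjunction X' Y' F' G' \<eta>' e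
  for X :: "('o1, 'm1) cat" and Y :: "('o2, 'm2) cat" and F G \<eta> \<epsilon>
    and X' :: "('o3, 'm3) cat" and Y' :: "('o4, 'm4) cat" and I J F' G' \<eta>' e +
  fixes \<theta> :: "'o4 \<Rightarrow> 'm1"
  assumes \<theta>_hom: "y \<in> Obj Y' \<Longrightarrow>
      \<theta> y \<in> hom X (ObjMap I (ObjMap G' y)) (ObjMap G (ObjMap J y))"
    and \<theta>_iso: "y \<in> Obj Y' \<Longrightarrow> is_iso X (\<theta> y)"
    and counit_square:
      "y \<in> Obj Y' \<Longrightarrow> ArrMap J (e y) = \<epsilon> (ObjMap J y) \<cdot>\<^bsub>Y\<^esub> ArrMap F (\<theta> y)"
begin

lemma \<theta>_arr [simp]:
  assumes "y \<in> Obj Y'"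
  shows "\<theta> y \<in> Arr X" "Dom X (\<theta> y) = ObjMap I (ObjMap G' y)" "Cod X (\<theta> y) = ObjMap G (ObjMap J y)"
  using F.A.homE[OF \<theta>_hom[OF assms]] by auto

lemma \<theta>_natural:
  assumes f: "f \<in> hom Y' y z"
  shows "\<theta> z \<cdot>\<^bsub>X\<^esub> ArrMap I (ArrMap G' f) = ArrMap G (ArrMap J f) \<cdot>\<^bsub>X\<^esub> \<theta> y"
proof -
  note c = J.A.homE[OF f]
  have "\<epsilon> (ObjMap J z) \<cdot>\<^bsub>Y\<^esub> ArrMap F (\<theta> z \<cdot>\<^bsub>X\<^esub> ArrMap I (ArrMap G' f))
      = ArrMap J (e z \<cdot>\<^bsub>Y'\<^esub> ArrMap F' (ArrMap G' f))"
    using c by (simp add: counit_square)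
  also have "\<dots> = ArrMap J (f \<cdot>\<^bsub>Y'\<^esub> e y)" by (simp only: restr.counit_natural[OF f])
  also have "\<dots> = (ArrMap J f \<cdot>\<^bsub>Y\<^esub> \<epsilon> (ObjMap J y)) \<cdot>\<^bsub>Y\<^esub> ArrMap F (\<theta> y)"
    using c by (simp add: counit_square)
  also have "\<dots> = (\<epsilon> (ObjMap J z) \<cdot>\<^bsub>Y\<^esub> ArrMap F (ArrMap G (ArrMap J f))) \<cdot>\<^bsub>Y\<^esub> ArrMap F (\<theta> y)"
    by (simp only: counit_natural[OF J.ArrMap_hom[OF f]])
  also have "\<dots> = \<epsilon> (ObjMap J z) \<cdot>\<^bsub>Y\<^esub> ArrMap F (ArrMap G (ArrMap J f) \<cdot>\<^bsub>X\<^esub> \<theta> y)"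
    using c by simp
  finally show ?thesis
    by (rule counit_cancel[of _ _ "ObjMap I (ObjMap G' y)", rotated 3])
      (use c in \<open>simp_all add: hom_def\<close>)
qed

text \<open>Through \<open>\<theta>\<close>, the functor \<open>I\<close> turns the restricted monad into the original one. The next three lemmas are this
  for the unit, for the action on arrows, and for the structure maps of canonical algebras (hence for
  the multiplication).\<close>

lemma unit_square:
  assumes x: "x \<in> Obj X'"
  shows "\<theta> (ObjMap F' x) \<cdot>\<^bsub>X\<^esub> ArrMap I (\<eta>' x) = \<eta> (ObjMap I x)"
proof -
  let ?y = "ObjMap F' x"
  have "\<epsilon> (ObjMap F (ObjMap I x)) \<cdot>\<^bsub>Y\<^esub> ArrMap F (\<theta> ?y \<cdot>\<^bsub>X\<^esub> ArrMap I (\<eta>' x))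
      = ArrMap J (e ?y \<cdot>\<^bsub>Y'\<^esub> ArrMap F' (\<eta>' x))"
    using x by (simp add: counit_square)
  also have "\<dots> = \<epsilon> (ObjMap F (ObjMap I x)) \<cdot>\<^bsub>Y\<^esub> ArrMap F (\<eta> (ObjMap I x))"
    using x by (simp add: restr.triangle_left triangle_left)
  finally show ?thesis
    by (rule counit_cancel[of _ _ "ObjMap I x", rotated 3])
      (use x in \<open>simp_all add: hom_def\<close>)
qed

lemma free_square:
  assumes h: "h \<in> hom X' w x"
  shows "\<theta> (ObjMap F' x) \<cdot>\<^bsub>X\<^esub> ArrMap I (ArrMap G' (ArrMap F' h))
    = ArrMap G (ArrMap F (ArrMap I h)) \<cdot>\<^bsub>X\<^esub> \<theta> (ObjMap F' w)"
  using \<theta>_natural[OF F'.ArrMap_hom[OF h]] I.A.homE[OF h] by simp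

lemma action_square:
  assumes y: "y \<in> Obj Y'"
  shows "ArrMap G (\<epsilon> (ObjMap J y)) \<cdot>\<^bsub>X\<^esub> (ArrMap G (ArrMap F (\<theta> y)) \<cdot>\<^bsub>X\<^esub> \<theta> (ObjMap F' (ObjMap G' y)))
    = \<theta> y \<cdot>\<^bsub>X\<^esub> ArrMap I (ArrMap G' (e y))"
  using \<theta>_natural[OF restr.counit_hom[OF y]] y by (simp add: counit_square)

lemma action_iso:
  assumes y: "y \<in> Obj Y'"
  defines "i \<equiv> ArrMap G (ArrMap F (\<theta> y)) \<cdot>\<^bsub>X\<^esub> \<theta> (ObjMap F' (ObjMap G' y))"
  shows "i \<in> hom X (ObjMap I (ObjMap G' (ObjMap F' (ObjMap G' y))))
      (ObjMap G (ObjMap F (ObjMap G (ObjMap J y))))" "is_iso X i"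
proof -
  have o: "ObjMap F' (ObjMap G' y) \<in> Obj Y'" using y by simp
  have 1: "\<theta> (ObjMap F' (ObjMap G' y)) \<in> hom X (ObjMap I (ObjMap G' (ObjMap F' (ObjMap G' y))))
      (ObjMap G (ObjMap F (ObjMap I (ObjMap G' y))))"
    using \<theta>_hom[OF o] y by simp
  note 2 = G.ArrMap_hom[OF F.ArrMap_hom[OF \<theta>_hom[OF y]]]
  show "i \<in> hom X (ObjMap I (ObjMap G' (ObjMap F' (ObjMap G' y))))
      (ObjMap G (ObjMap F (ObjMap G (ObjMap J y))))"
    unfolding i_def by (rule F.A.Comp_hom[OF 1 2])
  show "is_iso X i"
    unfolding i_def
    by (rule F.A.is_iso_Comp[OF \<theta>_iso[OF o] 1 G.preserves_iso[OF F.preserves_iso[OF \<theta>_iso[OF y]]] 2])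
qed

lemma restricted_faithful:
  assumes faithful: "\<And>y z f g. \<lbrakk>f \<in> hom Y y z; g \<in> hom Y y z; ArrMap G f = ArrMap G g\<rbrakk> \<Longrightarrow> f = g"
    and f: "f \<in> hom Y' y z" and g: "g \<in> hom Y' y z" and eq: "ArrMap G' f = ArrMap G' g"
  shows "f = g"
proof -
  have y: "y \<in> Obj Y'" using J.A.homE[OF f] by simp
  have "ArrMap G (ArrMap J f) \<cdot>\<^bsub>X\<^esub> \<theta> y = ArrMap G (ArrMap J g) \<cdot>\<^bsub>X\<^esub> \<theta> y"
    by (simp only: \<theta>_natural[OF f, symmetric] \<theta>_natural[OF g, symmetric] eq)
  then have "ArrMap G (ArrMap J f) = ArrMap G (ArrMap J g)"
    by (rule F.A.is_iso_cancel_right[OF \<theta>_iso[OF y] \<theta>_hom[OF y]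
          G.ArrMap_hom[OF J.ArrMap_hom[OF f]] G.ArrMap_hom[OF J.ArrMap_hom[OF g]]])
  then have "ArrMap J f = ArrMap J g"
    by (rule faithful[OF J.ArrMap_hom[OF f] J.ArrMap_hom[OF g]])
  then show ?thesis by (rule full_faithful_faithful[OF J_ff f g])
qed

text \<open>Conjugation with \<open>\<theta>\<close> makes \<open>I h\<close> a morphism of canonical algebras over \<open>X\<close>, which has a preimage
  in \<open>Y\<close> and then in \<open>Y'\<close>. The algebra law may be checked after composing with the isomorphism of
  lemma \<open>action_iso\<close>, where the squares above apply.\<close>

lemma restricted_full:
  assumes full: "\<And>y z h. \<lbrakk>y \<in> Obj Y; z \<in> Obj Y; h \<in> hom X (ObjMap G y) (ObjMap G z);
      h \<cdot>\<^bsub>X\<^esub> ArrMap G (\<epsilon> y) = ArrMap G (\<epsilon> z) \<cdot>\<^bsub>X\<^esub> ArrMap G (ArrMap F h)\<rbrakk> \<Longrightarrow>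
      \<exists>f\<in>hom Y y z. ArrMap G f = h"
    and y: "y \<in> Obj Y'" and z: "z \<in> Obj Y'" and h: "h \<in> hom X' (ObjMap G' y) (ObjMap G' z)"
    and h_alg: "h \<cdot>\<^bsub>X'\<^esub> ArrMap G' (e y) = ArrMap G' (e z) \<cdot>\<^bsub>X'\<^esub> ArrMap G' (ArrMap F' h)"
  shows "\<exists>f\<in>hom Y' y z. ArrMap G' f = h"
proof -
  obtain t where t: "t \<in> hom X (ObjMap G (ObjMap J y)) (ObjMap I (ObjMap G' y))"
      "t \<cdot>\<^bsub>X\<^esub> \<theta> y = Ident X (ObjMap I (ObjMap G' y))"
      "\<theta> y \<cdot>\<^bsub>X\<^esub> t = Ident X (ObjMap G (ObjMap J y))"
    using F.A.is_isoE[OF \<theta>_iso[OF y] \<theta>_hom[OF y]] .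
  define k where "k = \<theta> z \<cdot>\<^bsub>X\<^esub> (ArrMap I h \<cdot>\<^bsub>X\<^esub> t)"
  note c = y z I.A.homE[OF h] F.A.homE[OF t(1)]
  have k: "k \<in> hom X (ObjMap G (ObjMap J y)) (ObjMap G (ObjMap J z))"
    unfolding k_def using c by (simp add: hom_def)
  note ck = F.A.homE[OF k]
  have k\<theta>: "k \<cdot>\<^bsub>X\<^esub> \<theta> y = \<theta> z \<cdot>\<^bsub>X\<^esub> ArrMap I h"
    unfolding k_def using c by (simp add: t)
  let ?\<theta>\<theta> = "\<theta> (ObjMap F' (ObjMap G' y))"
  \<comment> \<open>The law \<open>k \<cdot> G (\<epsilon> (J y)) = G (\<epsilon> (J z)) \<cdot> G (F k)\<close>, composed with the invertible \<open>G (F (\<theta> y)) \<cdot> ?\<theta>\<theta>\<close>.\<close>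
  have "(k \<cdot>\<^bsub>X\<^esub> ArrMap G (\<epsilon> (ObjMap J y))) \<cdot>\<^bsub>X\<^esub> (ArrMap G (ArrMap F (\<theta> y)) \<cdot>\<^bsub>X\<^esub> ?\<theta>\<theta>)
      = k \<cdot>\<^bsub>X\<^esub> (ArrMap G (\<epsilon> (ObjMap J y)) \<cdot>\<^bsub>X\<^esub> (ArrMap G (ArrMap F (\<theta> y)) \<cdot>\<^bsub>X\<^esub> ?\<theta>\<theta>))"
    using c ck by simp
  also have "\<dots> = (k \<cdot>\<^bsub>X\<^esub> \<theta> y) \<cdot>\<^bsub>X\<^esub> ArrMap I (ArrMap G' (e y))"
    unfolding action_square[OF y] using c ck by simp
  also have "\<dots> = \<theta> z \<cdot>\<^bsub>X\<^esub> ArrMap I (h \<cdot>\<^bsub>X'\<^esub> ArrMap G' (e y))"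
    unfolding k\<theta> using c by simp
  also have "\<dots> = (\<theta> z \<cdot>\<^bsub>X\<^esub> ArrMap I (ArrMap G' (e z))) \<cdot>\<^bsub>X\<^esub> ArrMap I (ArrMap G' (ArrMap F' h))"
    unfolding h_alg using c by simp
  also have "\<dots> = (ArrMap G (\<epsilon> (ObjMap J z)) \<cdot>\<^bsub>X\<^esub> ArrMap G (ArrMap F (\<theta> z))) \<cdot>\<^bsub>X\<^esub>
      (\<theta> (ObjMap F' (ObjMap G' z)) \<cdot>\<^bsub>X\<^esub> ArrMap I (ArrMap G' (ArrMap F' h)))"
    unfolding action_square[OF z, symmetric] using c by simp
  also have "\<dots> = ArrMap G (\<epsilon> (ObjMap J z)) \<cdot>\<^bsub>X\<^esub>
      (ArrMap G (ArrMap F (\<theta> z \<cdot>\<^bsub>X\<^esub> ArrMap I h)) \<cdot>\<^bsub>X\<^esub> ?\<theta>\<theta>)"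
    unfolding free_square[OF h] using c by simp
  also have "\<dots> = (ArrMap G (\<epsilon> (ObjMap J z)) \<cdot>\<^bsub>X\<^esub> ArrMap G (ArrMap F k)) \<cdot>\<^bsub>X\<^esub>
      (ArrMap G (ArrMap F (\<theta> y)) \<cdot>\<^bsub>X\<^esub> ?\<theta>\<theta>)"
    unfolding k\<theta>[symmetric] using c ck by simp
  finally have "k \<cdot>\<^bsub>X\<^esub> ArrMap G (\<epsilon> (ObjMap J y)) = ArrMap G (\<epsilon> (ObjMap J z)) \<cdot>\<^bsub>X\<^esub> ArrMap G (ArrMap F k)"
    by (rule F.A.is_iso_cancel_right[OF action_iso(2,1)[OF y], rotated 2])
      (use c ck in \<open>simp_all add: hom_def\<close>)
  then obtain l where l: "l \<in> hom Y (ObjMap J y) (ObjMap J z)" "ArrMap G l = k"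
    using full[OF J.ObjMap_Obj[OF y] J.ObjMap_Obj[OF z] k] by blast
  obtain f where f: "f \<in> hom Y' y z" "ArrMap J f = l"
    using full_faithful_full[OF J_ff y z l(1)] .
  have "\<theta> z \<cdot>\<^bsub>X\<^esub> ArrMap I (ArrMap G' f) = \<theta> z \<cdot>\<^bsub>X\<^esub> ArrMap I h"
    unfolding \<theta>_natural[OF f(1)] f(2) l(2) by (rule k\<theta>)
  then have "ArrMap I (ArrMap G' f) = ArrMap I h"
    by (rule F.A.is_iso_cancel_left[OF \<theta>_iso[OF z] \<theta>_hom[OF z]
          I.ArrMap_hom[OF restr.G.ArrMap_hom[OF f(1)]] I.ArrMap_hom[OF h]])
  then have "ArrMap G' f = h"
    by (rule full_faithful_faithful[OF I_ff restr.G.ArrMap_hom[OF f(1)] h])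
  then show ?thesis using f(1) by blast
qed

text \<open>The structure map is \<open>I a\<close>, transported along \<open>\<theta>\<close>.\<close>

lemma image_algebra:
  assumes alg: "(x, a) \<in> restr.monad_algebras"
  obtains b where "(ObjMap I x, b) \<in> monad_algebras" "b \<cdot>\<^bsub>X\<^esub> \<theta> (ObjMap F' x) = ArrMap I a"
proof -
  have x: "x \<in> Obj X'" and a: "a \<in> hom X' (ObjMap G' (ObjMap F' x)) x"
    and a_unit: "a \<cdot>\<^bsub>X'\<^esub> \<eta>' x = Ident X' x"
    and a_mult: "a \<cdot>\<^bsub>X'\<^esub> ArrMap G' (e (ObjMap F' x)) = a \<cdot>\<^bsub>X'\<^esub> ArrMap G' (ArrMap F' a)"
    using alg by (auto simp: algebras_def)
  have y: "ObjMap F' x \<in> Obj Y'" using x by simp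
  let ?\<tau> = "\<theta> (ObjMap F' x)"
  have \<tau>: "?\<tau> \<in> hom X (ObjMap I (ObjMap G' (ObjMap F' x))) (ObjMap G (ObjMap F (ObjMap I x)))"
    using \<theta>_hom[OF y] x by simp
  obtain t where t: "t \<in> hom X (ObjMap G (ObjMap F (ObjMap I x))) (ObjMap I (ObjMap G' (ObjMap F' x)))"
      "t \<cdot>\<^bsub>X\<^esub> ?\<tau> = Ident X (ObjMap I (ObjMap G' (ObjMap F' x)))"
      "?\<tau> \<cdot>\<^bsub>X\<^esub> t = Ident X (ObjMap G (ObjMap F (ObjMap I x)))"
    using F.A.is_isoE[OF \<theta>_iso[OF y] \<tau>] .
  define b where "b = ArrMap I a \<cdot>\<^bsub>X\<^esub> t"
  note c = x I.A.homE[OF a] F.A.homE[OF t(1)]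
  have b: "b \<in> hom X (ObjMap G (ObjMap F (ObjMap I x))) (ObjMap I x)"
    unfolding b_def using c by (simp add: hom_def)
  note cb = F.A.homE[OF b]
  have b\<tau>: "b \<cdot>\<^bsub>X\<^esub> ?\<tau> = ArrMap I a"
    unfolding b_def using c by (simp add: t)
  have "b \<cdot>\<^bsub>X\<^esub> \<eta> (ObjMap I x) = (b \<cdot>\<^bsub>X\<^esub> ?\<tau>) \<cdot>\<^bsub>X\<^esub> ArrMap I (\<eta>' x)"
    unfolding unit_square[OF x, symmetric] using c cb by simp
  also have "\<dots> = ArrMap I (a \<cdot>\<^bsub>X'\<^esub> \<eta>' x)" unfolding b\<tau> using c by simp
  finally have b_unit: "b \<cdot>\<^bsub>X\<^esub> \<eta> (ObjMap I x) = Ident X (ObjMap I x)"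
    unfolding a_unit using x by simp
  let ?\<theta>\<theta> = "\<theta> (ObjMap F' (ObjMap G' (ObjMap F' x)))"
  \<comment> \<open>The associativity law of \<open>b\<close>, composed with the invertible \<open>G (F ?\<tau>) \<cdot> ?\<theta>\<theta>\<close>.\<close>
  have "(b \<cdot>\<^bsub>X\<^esub> ArrMap G (\<epsilon> (ObjMap F (ObjMap I x)))) \<cdot>\<^bsub>X\<^esub> (ArrMap G (ArrMap F ?\<tau>) \<cdot>\<^bsub>X\<^esub> ?\<theta>\<theta>)
      = b \<cdot>\<^bsub>X\<^esub> (ArrMap G (\<epsilon> (ObjMap J (ObjMap F' x))) \<cdot>\<^bsub>X\<^esub> (ArrMap G (ArrMap F ?\<tau>) \<cdot>\<^bsub>X\<^esub> ?\<theta>\<theta>))"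
    using c cb by simp
  also have "\<dots> = (b \<cdot>\<^bsub>X\<^esub> ?\<tau>) \<cdot>\<^bsub>X\<^esub> ArrMap I (ArrMap G' (e (ObjMap F' x)))"
    unfolding action_square[OF y] using c cb by simp
  also have "\<dots> = ArrMap I (a \<cdot>\<^bsub>X'\<^esub> ArrMap G' (e (ObjMap F' x)))"
    unfolding b\<tau> using c by simp
  also have "\<dots> = ArrMap I a \<cdot>\<^bsub>X\<^esub> ArrMap I (ArrMap G' (ArrMap F' a))"
    unfolding a_mult using c by simp
  also have "\<dots> = b \<cdot>\<^bsub>X\<^esub> (?\<tau> \<cdot>\<^bsub>X\<^esub> ArrMap I (ArrMap G' (ArrMap F' a)))"
    unfolding b\<tau>[symmetric] using c cb by simp
  also have "\<dots> = b \<cdot>\<^bsub>X\<^esub> (ArrMap G (ArrMap F (ArrMap I a)) \<cdot>\<^bsub>X\<^esub> ?\<theta>\<theta>)"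
    unfolding free_square[OF a] ..
  also have "\<dots> = (b \<cdot>\<^bsub>X\<^esub> ArrMap G (ArrMap F b)) \<cdot>\<^bsub>X\<^esub> (ArrMap G (ArrMap F ?\<tau>) \<cdot>\<^bsub>X\<^esub> ?\<theta>\<theta>)"
    unfolding b\<tau>[symmetric] using c cb by simp
  finally have "b \<cdot>\<^bsub>X\<^esub> ArrMap G (\<epsilon> (ObjMap F (ObjMap I x))) = b \<cdot>\<^bsub>X\<^esub> ArrMap G (ArrMap F b)"
    by (rule F.A.is_iso_cancel_right[OF action_iso(2,1)[OF y], rotated 2])
      (use c cb in \<open>simp_all add: hom_def\<close>)
  then have "(ObjMap I x, b) \<in> monad_algebras"
    using b b_unit x by (auto simp: algebras_def)
  then show thesis using b\<tau> by (rule that)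
qed

text \<open>The image algebra is isomorphic to the canonical algebra on some \<open>G y\<close>, but \<open>y\<close> may lie outside \<open>Y'\<close>. The arrow
  \<open>F (I x) \<rightarrow> y\<close> corresponding to this isomorphism starts in \<open>Y'\<close>, so it factors through the coreflection
  \<open>m\<close> of \<open>y\<close>. Transposing the factorization lifts the isomorphism to an arrow \<open>v\<close> into \<open>G (J s)\<close> with
  \<open>G m \<cdot> v\<close> invertible; since \<open>G m\<close> is monic, \<open>v\<close> is invertible, and so \<open>s\<close> represents the algebra.\<close>

lemma restricted_essentially_surjective:
  assumes ess: "\<And>x a. (x, a) \<in> monad_algebras \<Longrightarrow>
      \<exists>y\<in>Obj Y. \<exists>h\<in>hom X x (ObjMap G y). is_iso X h \<and>
        h \<cdot>\<^bsub>X\<^esub> a = ArrMap G (\<epsilon> y) \<cdot>\<^bsub>X\<^esub> ArrMap G (ArrMap F h)"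
    and coreflect: "\<And>y. y \<in> Obj Y \<Longrightarrow> \<exists>s\<in>Obj Y'. \<exists>m\<in>hom Y (ObjMap J s) y. is_monic Y m \<and>
      (\<forall>z\<in>Obj Y'. \<forall>f\<in>hom Y (ObjMap J z) y. \<exists>g\<in>hom Y (ObjMap J z) (ObjMap J s). m \<cdot>\<^bsub>Y\<^esub> g = f)"
    and alg: "(x, a) \<in> restr.monad_algebras"
  shows "\<exists>s\<in>Obj Y'. \<exists>h\<in>hom X' x (ObjMap G' s). is_iso X' h \<and>
    h \<cdot>\<^bsub>X'\<^esub> a = ArrMap G' (e s) \<cdot>\<^bsub>X'\<^esub> ArrMap G' (ArrMap F' h)"
proof -
  have x: "x \<in> Obj X'" and a: "a \<in> hom X' (ObjMap G' (ObjMap F' x)) x"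
    using alg by (auto simp: algebras_def)
  obtain b where b_alg: "(ObjMap I x, b) \<in> monad_algebras" and b\<tau>: "b \<cdot>\<^bsub>X\<^esub> \<theta> (ObjMap F' x) = ArrMap I a"
    using image_algebra[OF alg] .
  have b: "b \<in> hom X (ObjMap G (ObjMap F (ObjMap I x))) (ObjMap I x)"
    using b_alg by (auto simp: algebras_def)
  obtain y k where y: "y \<in> Obj Y" and k: "k \<in> hom X (ObjMap I x) (ObjMap G y)" "is_iso X k"
      "k \<cdot>\<^bsub>X\<^esub> b = ArrMap G (\<epsilon> y) \<cdot>\<^bsub>X\<^esub> ArrMap G (ArrMap F k)"
    using ess[OF b_alg] by blast
  obtain s m where s: "s \<in> Obj Y'" and m: "m \<in> hom Y (ObjMap J s) y" "is_monic Y m"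
    and m_lift: "\<forall>z\<in>Obj Y'. \<forall>f\<in>hom Y (ObjMap J z) y. \<exists>g\<in>hom Y (ObjMap J z) (ObjMap J s). m \<cdot>\<^bsub>Y\<^esub> g = f"
    using coreflect[OF y] by blast
  have "\<epsilon> y \<cdot>\<^bsub>Y\<^esub> ArrMap F k \<in> hom Y (ObjMap J (ObjMap F' x)) y"
    using x y F.A.homE[OF k(1)] by (simp add: hom_def)
  then have "\<exists>g\<in>hom Y (ObjMap J (ObjMap F' x)) (ObjMap J s). m \<cdot>\<^bsub>Y\<^esub> g = \<epsilon> y \<cdot>\<^bsub>Y\<^esub> ArrMap F k"
    using m_lift F'.ObjMap_Obj[OF x] by blast
  then obtain g where g: "g \<in> hom Y (ObjMap F (ObjMap I x)) (ObjMap J s)"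
      "m \<cdot>\<^bsub>Y\<^esub> g = \<epsilon> y \<cdot>\<^bsub>Y\<^esub> ArrMap F k"
    using x by auto
  define v where "v = ArrMap G g \<cdot>\<^bsub>X\<^esub> \<eta> (ObjMap I x)"
  have v: "v \<in> hom X (ObjMap I x) (ObjMap G (ObjMap J s))"
    unfolding v_def using transpose_hom[OF _ g(1)] x by simp
  note c = x y s I.A.homE[OF a] F.A.homE[OF b] F.A.homE[OF k(1)] F.B.homE[OF m(1)]
    F.B.homE[OF g(1)] F.A.homE[OF v]
  have Gm_monic: "p = q" if "p \<in> hom X w (ObjMap G (ObjMap J s))" "q \<in> hom X w (ObjMap G (ObjMap J s))"
      "ArrMap G m \<cdot>\<^bsub>X\<^esub> p = ArrMap G m \<cdot>\<^bsub>X\<^esub> q" for p q w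
    using right_adjoint_preserves_monic[OF m(2), of p w q] that c by simp
  have "ArrMap G m \<cdot>\<^bsub>X\<^esub> v = ArrMap G (m \<cdot>\<^bsub>Y\<^esub> g) \<cdot>\<^bsub>X\<^esub> \<eta> (ObjMap I x)"
    unfolding v_def using c by simp
  also have "\<dots> = k" unfolding g(2) by (rule transpose_counit[OF y k(1)])
  finally have Gm_v: "ArrMap G m \<cdot>\<^bsub>X\<^esub> v = k" .
  have v_iso: "is_iso X v"
  proof -
    obtain k' where k': "k' \<in> hom X (ObjMap G y) (ObjMap I x)"
        "k' \<cdot>\<^bsub>X\<^esub> k = Ident X (ObjMap I x)" "k \<cdot>\<^bsub>X\<^esub> k' = Ident X (ObjMap G y)"
      using F.A.is_isoE[OF k(2,1)] .
    note ck' = c F.A.homE[OF k'(1)]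
    \<comment> \<open>As \<open>G m \<cdot> v = k\<close>, the inverse of \<open>v\<close> must be \<open>k' \<cdot> G m\<close>.\<close>
    have "ArrMap G m \<cdot>\<^bsub>X\<^esub> (v \<cdot>\<^bsub>X\<^esub> (k' \<cdot>\<^bsub>X\<^esub> ArrMap G m)) = ((ArrMap G m \<cdot>\<^bsub>X\<^esub> v) \<cdot>\<^bsub>X\<^esub> k') \<cdot>\<^bsub>X\<^esub> ArrMap G m"
      using ck' by simp
    also have "\<dots> = ArrMap G m \<cdot>\<^bsub>X\<^esub> Ident X (ObjMap G (ObjMap J s))"
      unfolding Gm_v k'(3) using ck' by simp
    finally have 1: "v \<cdot>\<^bsub>X\<^esub> (k' \<cdot>\<^bsub>X\<^esub> ArrMap G m) = Ident X (ObjMap G (ObjMap J s))"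
      by (rule Gm_monic[rotated 2]) (use ck' in \<open>simp_all add: hom_def\<close>)
    have 2: "(k' \<cdot>\<^bsub>X\<^esub> ArrMap G m) \<cdot>\<^bsub>X\<^esub> v = Ident X (ObjMap I x)"
      using ck' by (simp add: Gm_v k')
    show ?thesis
      by (rule F.A.is_isoI[OF v _ 2 1]) (use ck' in \<open>simp add: hom_def\<close>)
  qed
  \<comment> \<open>\<open>v\<close> is a morphism of algebras because \<open>k = G m \<cdot> v\<close> is one and \<open>G m\<close> can be cancelled.\<close>
  have "ArrMap G m \<cdot>\<^bsub>X\<^esub> (v \<cdot>\<^bsub>X\<^esub> b) = (ArrMap G m \<cdot>\<^bsub>X\<^esub> v) \<cdot>\<^bsub>X\<^esub> b" using c by simp
  also have "\<dots> = ArrMap G (\<epsilon> y) \<cdot>\<^bsub>X\<^esub> ArrMap G (ArrMap F (ArrMap G m \<cdot>\<^bsub>X\<^esub> v))"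
    unfolding Gm_v by (rule k(3))
  also have "\<dots> = ArrMap G (\<epsilon> y \<cdot>\<^bsub>Y\<^esub> ArrMap F (ArrMap G m)) \<cdot>\<^bsub>X\<^esub> ArrMap G (ArrMap F v)"
    using c by simp
  also have "\<dots> = ArrMap G m \<cdot>\<^bsub>X\<^esub> (ArrMap G (\<epsilon> (ObjMap J s)) \<cdot>\<^bsub>X\<^esub> ArrMap G (ArrMap F v))"
    unfolding counit_natural[OF m(1)] using c by simp
  finally have v_alg: "v \<cdot>\<^bsub>X\<^esub> b = ArrMap G (\<epsilon> (ObjMap J s)) \<cdot>\<^bsub>X\<^esub> ArrMap G (ArrMap F v)"
    by (rule Gm_monic[rotated 2]) (use c in \<open>simp_all add: hom_def\<close>)
  obtain t where t: "t \<in> hom X (ObjMap G (ObjMap J s)) (ObjMap I (ObjMap G' s))"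
      "t \<cdot>\<^bsub>X\<^esub> \<theta> s = Ident X (ObjMap I (ObjMap G' s))"
      "\<theta> s \<cdot>\<^bsub>X\<^esub> t = Ident X (ObjMap G (ObjMap J s))"
    using F.A.is_isoE[OF \<theta>_iso[OF s] \<theta>_hom[OF s]] .
  obtain h where h: "h \<in> hom X' x (ObjMap G' s)" "ArrMap I h = t \<cdot>\<^bsub>X\<^esub> v"
    using full_faithful_full[OF I_ff x restr.G.ObjMap_Obj[OF s] F.A.Comp_hom[OF v t(1)]] .
  note ch = c I.A.homE[OF h(1)] F.A.homE[OF t(1)]
  have "\<theta> s \<cdot>\<^bsub>X\<^esub> ArrMap I h = (\<theta> s \<cdot>\<^bsub>X\<^esub> t) \<cdot>\<^bsub>X\<^esub> v" unfolding h(2) using ch by simp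
  then have \<theta>_h: "\<theta> s \<cdot>\<^bsub>X\<^esub> ArrMap I h = v" using ch by (simp add: t)
  have "is_iso X (ArrMap I h)"
    unfolding h(2)
    by (rule F.A.is_iso_Comp[OF v_iso v F.A.is_iso_inverse[OF t(2,3) \<theta>_hom[OF s] t(1)] t(1)])
  then have h_iso: "is_iso X' h" by (rule full_faithful_reflects_iso[OF I_ff h(1)])
  \<comment> \<open>It suffices to compare the two sides after applying \<open>I\<close> and composing with \<open>\<theta> s\<close>.\<close>
  have "\<theta> s \<cdot>\<^bsub>X\<^esub> ArrMap I (h \<cdot>\<^bsub>X'\<^esub> a) = (\<theta> s \<cdot>\<^bsub>X\<^esub> ArrMap I h) \<cdot>\<^bsub>X\<^esub> ArrMap I a"
    using ch by simp
  also have "\<dots> = (v \<cdot>\<^bsub>X\<^esub> b) \<cdot>\<^bsub>X\<^esub> \<theta> (ObjMap F' x)"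
    unfolding \<theta>_h b\<tau>[symmetric] using ch by simp
  also have "\<dots> = ArrMap G (\<epsilon> (ObjMap J s)) \<cdot>\<^bsub>X\<^esub>
      (ArrMap G (ArrMap F (\<theta> s \<cdot>\<^bsub>X\<^esub> ArrMap I h)) \<cdot>\<^bsub>X\<^esub> \<theta> (ObjMap F' x))"
    unfolding v_alg \<theta>_h using ch by simp
  also have "\<dots> = ArrMap G (\<epsilon> (ObjMap J s)) \<cdot>\<^bsub>X\<^esub> (ArrMap G (ArrMap F (\<theta> s)) \<cdot>\<^bsub>X\<^esub>
      (ArrMap G (ArrMap F (ArrMap I h)) \<cdot>\<^bsub>X\<^esub> \<theta> (ObjMap F' x)))"
    using ch by simp
  also have "\<dots> = (ArrMap G (\<epsilon> (ObjMap J s)) \<cdot>\<^bsub>X\<^esub> (ArrMap G (ArrMap F (\<theta> s)) \<cdot>\<^bsub>X\<^esub>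
      \<theta> (ObjMap F' (ObjMap G' s)))) \<cdot>\<^bsub>X\<^esub> ArrMap I (ArrMap G' (ArrMap F' h))"
    unfolding free_square[OF h(1), symmetric] using ch by simp
  also have "\<dots> = \<theta> s \<cdot>\<^bsub>X\<^esub> ArrMap I (ArrMap G' (e s) \<cdot>\<^bsub>X'\<^esub> ArrMap G' (ArrMap F' h))"
    unfolding action_square[OF s] using ch by simp
  finally have "ArrMap I (h \<cdot>\<^bsub>X'\<^esub> a) = ArrMap I (ArrMap G' (e s) \<cdot>\<^bsub>X'\<^esub> ArrMap G' (ArrMap F' h))"
    by (rule F.A.is_iso_cancel_left[OF \<theta>_iso[OF s] \<theta>_hom[OF s], rotated 2])
      (use ch in \<open>simp_all add: hom_def\<close>)
  then have "h \<cdot>\<^bsub>X'\<^esub> a = ArrMap G' (e s) \<cdot>\<^bsub>X'\<^esub> ArrMap G' (ArrMap F' h)"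
    by (rule full_faithful_faithful[OF I_ff, rotated 2]) (use ch in \<open>simp_all add: hom_def\<close>)
  then show ?thesis using s h(1) h_iso by blast
qed

end

text \<open>The two conditions are that \<open>G\<close> maps \<open>Y'\<close> into the essential image of \<open>I\<close>, and that \<open>Y'\<close> is coreflective in
  \<open>Y\<close> with monic coreflections. Monicity makes the factorizations unique, so only their
  existence is demanded.\<close>

theorem monadic_adjunction_restricts:
  assumes "adjunction_restriction X Y F G \<eta> \<epsilon> X' Y' I J F'"
    and monadic: "monadic_adjunction X Y F G \<eta> \<epsilon>"
    and image: "\<And>y. y \<in> Obj Y' \<Longrightarrow>
      \<exists>x\<in>Obj X'. \<exists>t\<in>hom X (ObjMap I x) (ObjMap G (ObjMap J y)). is_iso X t"
    and coreflect: "\<And>y. y \<in> Obj Y \<Longrightarrow> \<exists>s\<in>Obj Y'. \<exists>m\<in>hom Y (ObjMap J s) y. is_monic Y m \<and>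
      (\<forall>z\<in>Obj Y'. \<forall>f\<in>hom Y (ObjMap J z) y. \<exists>g\<in>hom Y (ObjMap J z) (ObjMap J s). m \<cdot>\<^bsub>Y\<^esub> g = f)"
  obtains G' \<eta>' e where "monadic_adjunction X' Y' F' G' \<eta>' e"
proof -
  interpret adjunction_restriction X Y F G \<eta> \<epsilon> X' Y' I J F' by fact
  obtain G0 \<theta> where G0: "\<And>y. y \<in> Obj Y' \<Longrightarrow> G0 y \<in> Obj X'"
    and \<theta>: "\<And>y. y \<in> Obj Y' \<Longrightarrow> \<theta> y \<in> hom X (ObjMap I (G0 y)) (ObjMap G (ObjMap J y))"
      "\<And>y. y \<in> Obj Y' \<Longrightarrow> is_iso X (\<theta> y)"
    using image by metis
  obtain G' \<eta>' e where adj: "adjunction X' Y' F' G' \<eta>' e" and G': "ObjMap G' = G0"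
    and e: "\<And>y. y \<in> Obj Y' \<Longrightarrow> ArrMap J (e y) = \<epsilon> (ObjMap J y) \<cdot>\<^bsub>Y\<^esub> ArrMap F (\<theta> y)"
    using restricted_adjunction_exists[OF G0 \<theta>] by blast
  interpret restr: adjunction X' Y' F' G' \<eta>' e by (rule adj)
  interpret restricted_adjunction X Y F G \<eta> \<epsilon> X' Y' I J F' G' \<eta>' e \<theta>
    by unfold_locales (use \<theta> e G' in auto)
  have "monadic_adjunction X' Y' F' G' \<eta>' e"
    unfolding restr.monadic_adjunction_iff
  proof (intro conjI allI ballI impI)
    show "f = g" if "f \<in> hom Y' y z" "g \<in> hom Y' y z" "ArrMap G' f = ArrMap G' g" for f g y z
      using monadic[unfolded monadic_adjunction_iff] that
      by (intro restricted_faithful[of f y z g]) blast+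
    show "\<exists>f\<in>hom Y' y z. ArrMap G' f = h"
      if "y \<in> Obj Y'" "z \<in> Obj Y'" "h \<in> hom X' (ObjMap G' y) (ObjMap G' z)"
        "h \<cdot>\<^bsub>X'\<^esub> ArrMap G' (e y) = ArrMap G' (e z) \<cdot>\<^bsub>X'\<^esub> ArrMap G' (ArrMap F' h)" for y z h
      using monadic[unfolded monadic_adjunction_iff] that
      by (intro restricted_full[of y z h]) blast+
    show "\<exists>y\<in>Obj Y'. \<exists>h\<in>hom X' x (ObjMap G' y). is_iso X' h \<and>
        h \<cdot>\<^bsub>X'\<^esub> a = ArrMap G' (e y) \<cdot>\<^bsub>X'\<^esub> ArrMap G' (ArrMap F' h)"
      if "(x, a) \<in> restr.monad_algebras" for x a
      using monadic[unfolded monadic_adjunction_iff] that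
      by (intro restricted_essentially_surjective[OF _ coreflect]) blast+
  qed
  then show thesis by (rule that)
qed

section \<open>Slices\<close>

lemma slice_Obj: "Obj (slice C b) = {f \<in> Arr C. Cod C f = b}"
  by (simp add: slice_def)

lemma slice_hom_iff:
  "m \<in> hom (slice C b) f g \<longleftrightarrow> (\<exists>h. m = (f, h, g) \<and> f \<in> Arr C \<and> Cod C f = b \<and>
    g \<in> Arr C \<and> Cod C g = b \<and> h \<in> hom C (Dom C f) (Dom C g) \<and> g \<cdot>\<^bsub>C\<^esub> h = f)"
  by (auto simp: slice_def hom_def)

lemma slice_Comp [simp]: "(g, k, l) \<cdot>\<^bsub>slice C b\<^esub> (f, h, g') = (f, k \<cdot>\<^bsub>C\<^esub> h, l)"
  by (simp add: slice_def)

lemma slice_Ident [simp]: "Ident (slice C b) f = (f, Ident C (Dom C f), f)"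
  by (simp add: slice_def)

lemma slice_Dom [simp]: "Dom (slice C b) (f, h, g) = f"
  by (simp add: slice_def)

lemma slice_post_simps [simp]:
  "ObjMap (slice_post C p) f = p \<cdot>\<^bsub>C\<^esub> f"
  "ArrMap (slice_post C p) (f, h, g) = (p \<cdot>\<^bsub>C\<^esub> f, h, p \<cdot>\<^bsub>C\<^esub> g)"
  by (simp_all add: slice_post_def)

lemma slice_is_iso:
  assumes C: "category C" and m: "(f, h, g) \<in> hom (slice C b) f g" and iso: "is_iso C h"
  shows "is_iso (slice C b) (f, h, g)"
proof -
  interpret category C by (rule C)
  interpret S: category "slice C b" by (rule slice_category[OF C])
  have fg: "f \<in> Arr C" "Cod C f = b" "g \<in> Arr C" "Cod C g = b"
    and h: "h \<in> hom C (Dom C f) (Dom C g)" and gh: "g \<cdot>\<^bsub>C\<^esub> h = f"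
    using m by (auto simp: slice_hom_iff)
  obtain k where k: "k \<in> hom C (Dom C g) (Dom C f)"
      "k \<cdot>\<^bsub>C\<^esub> h = Ident C (Dom C f)" "h \<cdot>\<^bsub>C\<^esub> k = Ident C (Dom C g)"
    using is_isoE[OF iso h] .
  note c = fg homE[OF h] homE[OF k(1)]
  have "f \<cdot>\<^bsub>C\<^esub> k = g \<cdot>\<^bsub>C\<^esub> (h \<cdot>\<^bsub>C\<^esub> k)" unfolding gh[symmetric] using c by simp
  then have "f \<cdot>\<^bsub>C\<^esub> k = g" using c k(3) by simp
  then have "(g, k, f) \<in> hom (slice C b) g f" using fg k(1) by (simp add: slice_hom_iff)
  from S.is_isoI[OF m this] show ?thesis using k by simp
qed

lemma slice_is_monic:
  assumes C: "category C" and m: "(f, h, g) \<in> hom (slice C b) f g" and mono: "is_monic C h"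
  shows "is_monic (slice C b) (f, h, g)"
proof -
  interpret category C by (rule C)
  have h: "h \<in> hom C (Dom C f) (Dom C g)" using m by (auto simp: slice_hom_iff)
  show ?thesis
    unfolding is_monic_def
  proof (intro conjI ballI impI)
    show "(f, h, g) \<in> Arr (slice C b)" using m by (simp add: hom_def)
    fix x k l
    assume "k \<in> hom (slice C b) x (Dom (slice C b) (f, h, g))"
      and "l \<in> hom (slice C b) x (Dom (slice C b) (f, h, g))"
      and eq: "(f, h, g) \<cdot>\<^bsub>slice C b\<^esub> k = (f, h, g) \<cdot>\<^bsub>slice C b\<^esub> l"
    then obtain k' l' where kl: "k = (x, k', f)" "k' \<in> hom C (Dom C x) (Dom C f)"
        "l = (x, l', f)" "l' \<in> hom C (Dom C x) (Dom C f)"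
      unfolding slice_Dom slice_hom_iff by blast
    have "h \<cdot>\<^bsub>C\<^esub> k' = h \<cdot>\<^bsub>C\<^esub> l'" using eq unfolding kl by simp
    then show "k = l"
      using is_monicD[OF mono h kl(2,4)] unfolding kl by simp
  qed
qed

text \<open>A commutative square \<open>p \<cdot> h = f \<cdot> k\<close> is the same as an arrow \<open>k\<close> from \<open>p\<^sub>! h\<close> to \<open>f\<close> over the codomain of \<open>p\<close>. Its
  transpose is an arrow from \<open>h\<close> to \<open>P f\<close>, and the arrow underlying the transpose is the mediating one.\<close>

lemma slice_adjunction_is_pullback:
  assumes C: "category C" and p: "p \<in> Arr C"
    and adj: "adjunction (slice C (Dom C p)) (slice C (Cod C p)) (slice_post C p) P \<eta> \<epsilon>"
    and f: "f \<in> Arr C" "Cod C f = Cod C p"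
  shows "is_pullback C p f (ObjMap P f) (fst (snd (\<epsilon> f)))"
proof -
  interpret category C by (rule C)
  interpret adjunction "slice C (Dom C p)" "slice C (Cod C p)" "slice_post C p" P \<eta> \<epsilon> by (rule adj)
  let ?r = "ObjMap P f"
  have fO: "f \<in> Obj (slice C (Cod C p))" using f by (simp add: slice_Obj)
  have r: "?r \<in> Arr C" "Cod C ?r = Dom C p"
    using G.ObjMap_Obj[OF fO] by (simp_all add: slice_Obj)
  obtain q where q: "\<epsilon> f = (p \<cdot>\<^bsub>C\<^esub> ?r, q, f)" "q \<in> hom C (Dom C ?r) (Dom C f)"
      "f \<cdot>\<^bsub>C\<^esub> q = p \<cdot>\<^bsub>C\<^esub> ?r"
    using counit_hom[OF fO] r p by (auto simp: slice_hom_iff)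
  have lift: "(h, u, ?r) \<in> hom (slice C (Dom C p)) h ?r"
    if "h \<in> hom C x (Dom C p)" "u \<in> hom C x (Dom C ?r)" "?r \<cdot>\<^bsub>C\<^esub> u = h" for x h u
    using that r homE[OF that(1)] homE[OF that(2)] unfolding slice_hom_iff by simp
  have "\<exists>!u. u \<in> hom C x (Dom C ?r) \<and> ?r \<cdot>\<^bsub>C\<^esub> u = h \<and> q \<cdot>\<^bsub>C\<^esub> u = k"
    if h: "h \<in> hom C x (Dom C p)" and k: "k \<in> hom C x (Dom C f)" and eq: "p \<cdot>\<^bsub>C\<^esub> h = f \<cdot>\<^bsub>C\<^esub> k"
    for x h k
  proof (rule ex_ex1I)
    have hO: "h \<in> Obj (slice C (Dom C p))" using homE[OF h] by (simp add: slice_Obj)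
    have m: "(p \<cdot>\<^bsub>C\<^esub> h, k, f) \<in> hom (slice C (Cod C p)) (ObjMap (slice_post C p) h) f"
      using homE[OF h] homE[OF k] p f eq unfolding slice_hom_iff by (simp add: hom_def)
    obtain u where u: "ArrMap P (p \<cdot>\<^bsub>C\<^esub> h, k, f) \<cdot>\<^bsub>slice C (Dom C p)\<^esub> \<eta> h = (h, u, ?r)"
        "u \<in> hom C x (Dom C ?r)" "?r \<cdot>\<^bsub>C\<^esub> u = h"
      using transpose_hom[OF hO m] homE[OF h] by (auto simp: slice_hom_iff)
    have "q \<cdot>\<^bsub>C\<^esub> u = k" using counit_transpose[OF hO m] unfolding u(1) q(1) by simp
    then show "\<exists>u. u \<in> hom C x (Dom C ?r) \<and> ?r \<cdot>\<^bsub>C\<^esub> u = h \<and> q \<cdot>\<^bsub>C\<^esub> u = k" using u by blast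
  next
    fix u v
    assume u: "u \<in> hom C x (Dom C ?r) \<and> ?r \<cdot>\<^bsub>C\<^esub> u = h \<and> q \<cdot>\<^bsub>C\<^esub> u = k"
      and v: "v \<in> hom C x (Dom C ?r) \<and> ?r \<cdot>\<^bsub>C\<^esub> v = h \<and> q \<cdot>\<^bsub>C\<^esub> v = k"
    have "(h, u, ?r) = (h, v, ?r)"
      by (rule counit_cancel[OF fO lift[OF h] lift[OF h]]) (use u v q(1) in auto)
    then show "u = v" by simp
  qed
  moreover have "?r \<in> hom C (Dom C ?r) (Dom C p)" using r by (simp add: hom_def)
  ultimately show ?thesis
    using p f q(2) q(3)[symmetric] unfolding is_pullback_def q(1) fst_conv snd_conv by auto
qed

lemma effective_descent_iff:
  assumes C: "category C"
  shows "effective_descent C p \<longleftrightarrow> p \<in> Arr C \<and> (\<exists>P \<eta> \<epsilon>. monadic_adjunction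
    (slice C (Dom C p)) (slice C (Cod C p)) (slice_post C p) P \<eta> \<epsilon>)"
proof (intro iffI; (elim conjE exE)?)
  assume "effective_descent C p"
  then show "p \<in> Arr C \<and> (\<exists>P \<eta> \<epsilon>. monadic_adjunction
      (slice C (Dom C p)) (slice C (Cod C p)) (slice_post C p) P \<eta> \<epsilon>)"
    unfolding effective_descent_def has_pullbacks_along_def by blast
next
  fix P \<eta> \<epsilon>
  assume p: "p \<in> Arr C"
    and m: "monadic_adjunction (slice C (Dom C p)) (slice C (Cod C p)) (slice_post C p) P \<eta> \<epsilon>"
  then have adj: "adjunction (slice C (Dom C p)) (slice C (Cod C p)) (slice_post C p) P \<eta> \<epsilon>"
    by (simp add: monadic_adjunction_def)
  note pb = slice_adjunction_is_pullback[OF C p adj]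
  have "has_pullbacks_along C p" unfolding has_pullbacks_along_def using p pb by blast
  moreover have "pullback_adjunction C p P \<eta> \<epsilon>"
    unfolding pullback_adjunction_def using adj pb by (simp add: slice_Obj)
  ultimately show "effective_descent C p" unfolding effective_descent_def using m by blast
qed


section \<open>Cartesian coreflections with monic counit\<close>

text \<open>When \<open>e\<close> is the counit at \<open>c\<close>, the object \<open>f : x \<rightarrow> U c\<close> goes to its transpose \<open>L x \<rightarrow> c\<close>.\<close>

definition slice_transpose ::
  "('o2, 'm2) cat \<Rightarrow> ('o1, 'm1, 'o2, 'm2) func \<Rightarrow> 'm2 \<Rightarrow>
    ('m1, 'm1 \<times> 'm1 \<times> 'm1, 'm2, 'm2 \<times> 'm2 \<times> 'm2) func" where
  "slice_transpose C L e = \<lparr>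
     ObjMap = (\<lambda>f. e \<cdot>\<^bsub>C\<^esub> ArrMap L f),
     ArrMap = (\<lambda>(f, h, g). (e \<cdot>\<^bsub>C\<^esub> ArrMap L f, ArrMap L h, e \<cdot>\<^bsub>C\<^esub> ArrMap L g))\<rparr>"

lemma slice_transpose_simps [simp]:
  "ObjMap (slice_transpose C L e) f = e \<cdot>\<^bsub>C\<^esub> ArrMap L f"
  "ArrMap (slice_transpose C L e) (f, h, g) = (e \<cdot>\<^bsub>C\<^esub> ArrMap L f, ArrMap L h, e \<cdot>\<^bsub>C\<^esub> ArrMap L g)"
  by (simp_all add: slice_transpose_def)

locale cartesian_monic_coreflection = adjunction A C L U \<eta> \<epsilon>
  for A :: "('oa, 'ma) cat" and C :: "('oc, 'mc) cat" and L U \<eta> \<epsilon> +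
  assumes L_ff: "full_faithful A C L"
    and counit_monic: "c \<in> Obj C \<Longrightarrow> is_monic C (\<epsilon> c)"
    and counit_cartesian: "cartesian_nat_trans C C (L \<circ>\<^sub>F U) id_func \<epsilon>"
begin

text \<open>By cartesianness \<open>\<epsilon> d\<close> is a pullback of \<open>\<epsilon> (L x)\<close> along \<open>\<pi>\<close>. The latter has the section \<open>L (\<eta> x)\<close>, so \<open>\<epsilon> d\<close> has
  a section; being monic, it is invertible.\<close>

lemma counit_iso_of_arrow_into_image:
  assumes x: "x \<in> Obj A" and \<pi>: "\<pi> \<in> hom C d (ObjMap L x)"
  shows "is_iso C (\<epsilon> d)"
proof -
  note c = x F.B.homE[OF \<pi>]
  have eq: "\<pi> \<cdot>\<^bsub>C\<^esub> Ident C d = \<epsilon> (ObjMap L x) \<cdot>\<^bsub>C\<^esub> (ArrMap L (\<eta> x) \<cdot>\<^bsub>C\<^esub> \<pi>)"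
  proof -
    have "\<epsilon> (ObjMap L x) \<cdot>\<^bsub>C\<^esub> (ArrMap L (\<eta> x) \<cdot>\<^bsub>C\<^esub> \<pi>)
        = (\<epsilon> (ObjMap L x) \<cdot>\<^bsub>C\<^esub> ArrMap L (\<eta> x)) \<cdot>\<^bsub>C\<^esub> \<pi>" using c by simp
    then show ?thesis using c by (simp add: triangle_left)
  qed
  have "is_pullback C \<pi> (\<epsilon> (ObjMap L x)) (\<epsilon> d) (ArrMap L (ArrMap U \<pi>))"
    using counit_cartesian c unfolding cartesian_nat_trans_def by force
  then have univ: "\<forall>w\<in>Obj C. \<forall>h\<in>hom C w d. \<forall>k\<in>hom C w (Dom C (\<epsilon> (ObjMap L x))).
      \<pi> \<cdot>\<^bsub>C\<^esub> h = \<epsilon> (ObjMap L x) \<cdot>\<^bsub>C\<^esub> k \<longrightarrow>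
      (\<exists>!u. u \<in> hom C w (Dom C (\<epsilon> d)) \<and> \<epsilon> d \<cdot>\<^bsub>C\<^esub> u = h \<and> ArrMap L (ArrMap U \<pi>) \<cdot>\<^bsub>C\<^esub> u = k)"
    using c unfolding is_pullback_def by simp
  have "Ident C d \<in> hom C d d" "ArrMap L (\<eta> x) \<cdot>\<^bsub>C\<^esub> \<pi> \<in> hom C d (Dom C (\<epsilon> (ObjMap L x)))"
    using c by (simp_all add: hom_def)
  with univ eq c(5) obtain u where "u \<in> hom C d (Dom C (\<epsilon> d))" "\<epsilon> d \<cdot>\<^bsub>C\<^esub> u = Ident C d"
    by blast
  then show ?thesis
    using c by (intro F.B.monic_split_epi_is_iso[OF counit_monic counit_hom, of d u]) auto
qed

text \<open>Fullness: a triangle over \<open>c\<close> between objects in the image comes from an arrow \<open>h\<close> of \<open>A\<close> because \<open>L\<close> is full,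
  and \<open>h\<close> is a triangle over \<open>U c\<close> because the transposes of its two sides agree.\<close>

lemma slice_transpose_full_faithful:
  assumes c: "c \<in> Obj C"
  shows "full_faithful (slice A (ObjMap U c)) (slice C c) (slice_transpose C L (\<epsilon> c))"
proof -
  let ?A = "slice A (ObjMap U c)" and ?C = "slice C c" and ?S = "slice_transpose C L (\<epsilon> c)"
  interpret SA: category ?A by (rule slice_category[OF F.A.category_axioms])
  interpret SC: category ?C by (rule slice_category[OF F.B.category_axioms])
  have S: "is_functor ?A ?C ?S"
  proof
    fix f assume "f \<in> Obj ?A"
    then show "ObjMap ?S f \<in> Obj ?C" "ArrMap ?S (Ident ?A f) = Ident ?C (ObjMap ?S f)"
      using c by (simp_all add: slice_Obj)
  next
    fix m f g assume "m \<in> hom ?A f g"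
    then obtain h where h: "m = (f, h, g)" "f \<in> Arr A" "Cod A f = ObjMap U c" "g \<in> Arr A"
        "Cod A g = ObjMap U c" "h \<in> hom A (Dom A f) (Dom A g)" "g \<cdot>\<^bsub>A\<^esub> h = f"
      by (auto simp: slice_hom_iff)
    have "ArrMap L g \<cdot>\<^bsub>C\<^esub> ArrMap L h = ArrMap L f"
      using F.ArrMap_Comp_arr[of h g] h F.A.homE[OF h(6)] by simp
    then show "ArrMap ?S m \<in> hom ?C (ObjMap ?S f) (ObjMap ?S g)"
      using h c F.A.homE[OF h(6)] unfolding slice_hom_iff by (simp add: hom_def)
  next
    fix m f g n l assume "m \<in> hom ?A f g" "n \<in> hom ?A g l"
    then obtain h k where mn: "m = (f, h, g)" "n = (g, k, l)"
        and hk: "h \<in> hom A (Dom A f) (Dom A g)" "k \<in> hom A (Dom A g) (Dom A l)"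
      unfolding slice_hom_iff by blast
    show "ArrMap ?S (n \<cdot>\<^bsub>?A\<^esub> m) = ArrMap ?S n \<cdot>\<^bsub>?C\<^esub> ArrMap ?S m"
      unfolding mn using F.ArrMap_Comp[OF hk] by simp
  qed
  interpret S: is_functor ?A ?C ?S by (rule S)
  show ?thesis
    unfolding full_faithful_def bij_betw_def
  proof (intro conjI ballI S inj_onI subset_antisym)
    fix f g m n assume "m \<in> hom ?A f g" "n \<in> hom ?A f g" "ArrMap ?S m = ArrMap ?S n"
    then show "m = n" using full_faithful_faithful[OF L_ff] by (auto simp: slice_hom_iff)
  next
    show "ArrMap ?S ` hom ?A f g \<subseteq> hom ?C (ObjMap ?S f) (ObjMap ?S g)" for f g
      using S.ArrMap_hom by blast
  next
    fix f g assume "f \<in> Obj ?A" "g \<in> Obj ?A"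
    then have f: "f \<in> Arr A" "Cod A f = ObjMap U c" and g: "g \<in> Arr A" "Cod A g = ObjMap U c"
      by (simp_all add: slice_Obj)
    show "hom ?C (ObjMap ?S f) (ObjMap ?S g) \<subseteq> ArrMap ?S ` hom ?A f g"
    proof
      fix m assume "m \<in> hom ?C (ObjMap ?S f) (ObjMap ?S g)"
      then obtain k where k: "m = (ObjMap ?S f, k, ObjMap ?S g)"
          "k \<in> hom C (ObjMap L (Dom A f)) (ObjMap L (Dom A g))"
          "(\<epsilon> c \<cdot>\<^bsub>C\<^esub> ArrMap L g) \<cdot>\<^bsub>C\<^esub> k = \<epsilon> c \<cdot>\<^bsub>C\<^esub> ArrMap L f"
        using f g c by (auto simp: slice_hom_iff)
      obtain h where h: "h \<in> hom A (Dom A f) (Dom A g)" "ArrMap L h = k"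
        using full_faithful_full[OF L_ff _ _ k(2)] f g by auto
      have "\<epsilon> c \<cdot>\<^bsub>C\<^esub> ArrMap L (g \<cdot>\<^bsub>A\<^esub> h) = \<epsilon> c \<cdot>\<^bsub>C\<^esub> ArrMap L f"
        using k(3)[folded h(2)] f g c F.A.homE[OF h(1)] by simp
      then have "g \<cdot>\<^bsub>A\<^esub> h = f"
        by (rule counit_cancel[OF c, of _ "Dom A f", rotated 2])
          (use f g F.A.homE[OF h(1)] in \<open>simp_all add: hom_def\<close>)
      then have "(f, h, g) \<in> hom ?A f g" using f g h by (simp add: slice_hom_iff)
      then show "m \<in> ArrMap ?S ` hom ?A f g" using k(1) h(2) by force
    qed
  qed
qed

text \<open>The square of left adjoints commutes strictly by naturality of the counit at \<open>p\<close>.\<close>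

lemma slice_adjunction_restriction:
  assumes p: "p \<in> Arr C"
    and adj: "adjunction (slice C (Dom C p)) (slice C (Cod C p)) (slice_post C p) P \<eta>' \<epsilon>'"
  shows "adjunction_restriction (slice C (Dom C p)) (slice C (Cod C p)) (slice_post C p) P \<eta>' \<epsilon>'
    (slice A (ObjMap U (Dom C p))) (slice A (ObjMap U (Cod C p)))
    (slice_transpose C L (\<epsilon> (Dom C p))) (slice_transpose C L (\<epsilon> (Cod C p)))
    (slice_post A (ArrMap U p))"
proof -
  have I: "full_faithful (slice A (ObjMap U (Dom C p))) (slice C (Dom C p))
      (slice_transpose C L (\<epsilon> (Dom C p)))"
    and J: "full_faithful (slice A (ObjMap U (Cod C p))) (slice C (Cod C p))
      (slice_transpose C L (\<epsilon> (Cod C p)))"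
    using p by (simp_all add: slice_transpose_full_faithful)
  have F': "is_functor (slice A (ObjMap U (Dom C p))) (slice A (ObjMap U (Cod C p)))
      (slice_post A (ArrMap U p))"
    using slice_post_functor[OF F.A.category_axioms, of "ArrMap U p"] p by simp
  have square: "\<epsilon> (Cod C p) \<cdot>\<^bsub>C\<^esub> ArrMap L (ArrMap U p \<cdot>\<^bsub>A\<^esub> f)
      = p \<cdot>\<^bsub>C\<^esub> (\<epsilon> (Dom C p) \<cdot>\<^bsub>C\<^esub> ArrMap L f)"
    if f: "f \<in> Arr A" "Cod A f = ObjMap U (Dom C p)" for f
  proof -
    have ph: "p \<in> hom C (Dom C p) (Cod C p)" using p by (simp add: hom_def)
    have "\<epsilon> (Cod C p) \<cdot>\<^bsub>C\<^esub> ArrMap L (ArrMap U p \<cdot>\<^bsub>A\<^esub> f)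
        = (\<epsilon> (Cod C p) \<cdot>\<^bsub>C\<^esub> ArrMap L (ArrMap U p)) \<cdot>\<^bsub>C\<^esub> ArrMap L f"
      using p f by simp
    also have "\<dots> = p \<cdot>\<^bsub>C\<^esub> (\<epsilon> (Dom C p) \<cdot>\<^bsub>C\<^esub> ArrMap L f)"
      unfolding counit_natural[OF ph] using p f by simp
    finally show ?thesis .
  qed
  have I_fun: "is_functor (slice A (ObjMap U (Dom C p))) (slice C (Dom C p))
      (slice_transpose C L (\<epsilon> (Dom C p)))"
    and J_fun: "is_functor (slice A (ObjMap U (Cod C p))) (slice C (Cod C p))
      (slice_transpose C L (\<epsilon> (Cod C p)))"
    using I J by (simp_all add: full_faithful_def)
  show ?thesis
  proof (rule adjunction_restriction.intro[OF adj I_fun J_fun F'],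
      rule adjunction_restriction_axioms.intro[OF I J])
    fix f assume "f \<in> Obj (slice A (ObjMap U (Dom C p)))"
    then show "ObjMap (slice_transpose C L (\<epsilon> (Cod C p))) (ObjMap (slice_post A (ArrMap U p)) f)
        = ObjMap (slice_post C p) (ObjMap (slice_transpose C L (\<epsilon> (Dom C p))) f)"
      unfolding slice_transpose_simps slice_post_simps by (intro square) (simp_all add: slice_Obj)
  next
    fix m assume "m \<in> Arr (slice A (ObjMap U (Dom C p)))"
    then obtain f h g where m: "m = (f, h, g)" and fg: "f \<in> Arr A" "Cod A f = ObjMap U (Dom C p)"
        "g \<in> Arr A" "Cod A g = ObjMap U (Dom C p)"
      by (auto simp: slice_def)
    show "ArrMap (slice_transpose C L (\<epsilon> (Cod C p))) (ArrMap (slice_post A (ArrMap U p)) m)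
        = ArrMap (slice_post C p) (ArrMap (slice_transpose C L (\<epsilon> (Dom C p))) m)"
      unfolding m slice_transpose_simps slice_post_simps square[OF fg(1,2)] square[OF fg(3,4)] ..
  qed
qed

text \<open>The second projection maps the domain of the pullback \<open>r\<close> to \<open>L x\<close>, where \<open>x\<close> is the domain of \<open>f\<close>. Hence the
  counit at that domain is invertible, and it is an isomorphism over \<open>Dom C p\<close> from the transpose
  of \<open>U r\<close> to \<open>r\<close>.\<close>

lemma pullback_along_lies_in_image:
  assumes p: "p \<in> Arr C"
    and adj: "adjunction (slice C (Dom C p)) (slice C (Cod C p)) (slice_post C p) P \<eta>' \<epsilon>'"
    and f: "f \<in> Obj (slice A (ObjMap U (Cod C p)))"
  defines "r \<equiv> ObjMap P (\<epsilon> (Cod C p) \<cdot>\<^bsub>C\<^esub> ArrMap L f)"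
  shows "\<exists>g\<in>Obj (slice A (ObjMap U (Dom C p))).
    \<exists>t\<in>hom (slice C (Dom C p)) (\<epsilon> (Dom C p) \<cdot>\<^bsub>C\<^esub> ArrMap L g) r. is_iso (slice C (Dom C p)) t"
proof -
  interpret P: adjunction "slice C (Dom C p)" "slice C (Cod C p)" "slice_post C p" P \<eta>' \<epsilon>'
    by (rule adj)
  let ?f = "\<epsilon> (Cod C p) \<cdot>\<^bsub>C\<^esub> ArrMap L f"
  have f': "f \<in> Arr A" "Cod A f = ObjMap U (Cod C p)" using f by (simp_all add: slice_Obj)
  have fO: "?f \<in> Obj (slice C (Cod C p))" using f' p by (simp add: slice_Obj)
  have r: "r \<in> Arr C" "Cod C r = Dom C p"
    using P.G.ObjMap_Obj[OF fO] unfolding r_def by (simp_all add: slice_Obj)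
  have rh: "r \<in> hom C (Dom C r) (Dom C p)" using r by (simp add: hom_def)
  have "\<epsilon>' ?f \<in> hom (slice C (Cod C p)) (p \<cdot>\<^bsub>C\<^esub> r) ?f"
    using P.counit_hom[OF fO] unfolding r_def slice_post_simps .
  then obtain \<pi> where \<pi>: "\<pi> \<in> hom C (Dom C (p \<cdot>\<^bsub>C\<^esub> r)) (Dom C ?f)"
    unfolding slice_hom_iff by blast
  have "\<pi> \<in> hom C (Dom C r) (ObjMap L (Dom A f))" using \<pi> r p f' by simp
  then have iso: "is_iso C (\<epsilon> (Dom C r))"
    by (rule counit_iso_of_arrow_into_image[rotated]) (use f' in simp)
  have t: "(\<epsilon> (Dom C p) \<cdot>\<^bsub>C\<^esub> ArrMap L (ArrMap U r), \<epsilon> (Dom C r), r)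
      \<in> hom (slice C (Dom C p)) (\<epsilon> (Dom C p) \<cdot>\<^bsub>C\<^esub> ArrMap L (ArrMap U r)) r"
    using r p counit_natural[OF rh] unfolding slice_hom_iff by (simp add: hom_def)
  have "ArrMap U r \<in> Obj (slice A (ObjMap U (Dom C p)))" using r by (simp add: slice_Obj)
  then show ?thesis
    using t slice_is_iso[OF F.B.category_axioms t iso] by blast
qed

text \<open>The coreflection of \<open>f\<close> is the transpose of \<open>U f\<close>, mapped to \<open>f\<close> by the counit at the domain of \<open>f\<close>. An
  arrow \<open>h\<close> from an object of the image factors through it by \<open>L\<close> applied to the transpose of \<open>h\<close>.\<close>

lemma slice_coreflection:
  assumes c: "c \<in> Obj C" and f: "f \<in> Obj (slice C c)"
  defines "J \<equiv> \<lambda>g. \<epsilon> c \<cdot>\<^bsub>C\<^esub> ArrMap L g"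
  shows "\<exists>s\<in>Obj (slice A (ObjMap U c)). \<exists>m\<in>hom (slice C c) (J s) f. is_monic (slice C c) m \<and>
    (\<forall>z\<in>Obj (slice A (ObjMap U c)). \<forall>k\<in>hom (slice C c) (J z) f.
      \<exists>g\<in>hom (slice C c) (J z) (J s). m \<cdot>\<^bsub>slice C c\<^esub> g = k)"
proof -
  have f': "f \<in> Arr C" "Cod C f = c" and fh: "f \<in> hom C (Dom C f) c"
    using f by (simp_all add: slice_Obj hom_def)
  let ?x = "Dom C f" and ?s = "ArrMap U f"
  have Js: "J ?s = f \<cdot>\<^bsub>C\<^esub> \<epsilon> ?x" unfolding J_def by (rule counit_natural[OF fh])
  let ?m = "(J ?s, \<epsilon> ?x, f)"
  have m: "?m \<in> hom (slice C c) (J ?s) f"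
    using f' c unfolding slice_hom_iff Js by (simp add: hom_def)
  have "\<exists>g\<in>hom (slice C c) (J z) (J ?s). ?m \<cdot>\<^bsub>slice C c\<^esub> g = k"
    if z: "z \<in> Obj (slice A (ObjMap U c))" and k: "k \<in> hom (slice C c) (J z) f" for z k
  proof -
    have z': "z \<in> Arr A" "Cod A z = ObjMap U c" using z by (simp_all add: slice_Obj)
    have Jz: "J z \<in> Arr C" "Dom C (J z) = ObjMap L (Dom A z)" "Cod C (J z) = c"
      unfolding J_def using z' c by simp_all
    obtain h where h: "k = (J z, h, f)" "h \<in> hom C (ObjMap L (Dom A z)) ?x" "f \<cdot>\<^bsub>C\<^esub> h = J z"
      using k Jz by (auto simp: slice_hom_iff)
    have zO: "Dom A z \<in> Obj A" using z' by simp
    define g where "g = ArrMap L (ArrMap U h \<cdot>\<^bsub>A\<^esub> \<eta> (Dom A z))"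
    have g: "g \<in> hom C (ObjMap L (Dom A z)) (ObjMap L (ObjMap U ?x))" "\<epsilon> ?x \<cdot>\<^bsub>C\<^esub> g = h"
      unfolding g_def using F.ArrMap_hom[OF transpose_hom[OF zO h(2)]] counit_transpose[OF zO h(2)]
      by simp_all
    have "(f \<cdot>\<^bsub>C\<^esub> \<epsilon> ?x) \<cdot>\<^bsub>C\<^esub> g = J z"
      using f' h(3) g F.B.homE[OF g(1)] by simp
    then have "(J z, g, J ?s) \<in> hom (slice C c) (J z) (J ?s)"
      using Jz g(1) f' c unfolding slice_hom_iff Js by (simp add: hom_def)
    then show ?thesis using h(1) g(2) by force
  qed
  moreover have "is_monic (slice C c) ?m"
    using f' counit_monic by (intro slice_is_monic[OF F.B.category_axioms m]) simp
  moreover have "?s \<in> Obj (slice A (ObjMap U c))" using f' by (simp add: slice_Obj)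
  ultimately show ?thesis using m by blast
qed

end

theorem theorem12:
  fixes A :: "('oa, 'ma) cat" and C :: "('oc, 'mc) cat"
    and L :: "('oa, 'ma, 'oc, 'mc) func" and U :: "('oc, 'mc, 'oa, 'ma) func"
    and \<eta> :: "'oa \<Rightarrow> 'ma" and \<epsilon> :: "'oc \<Rightarrow> 'mc" and p :: 'mc
  assumes "adjunction A C L U \<eta> \<epsilon>"
    and "cartesian_nat_trans C C (L \<circ>\<^sub>F U) id_func \<epsilon>"
    and "\<forall>x \<in> Obj C. is_monic C (\<epsilon> x)"
    and "full_faithful A C L"
    and "effective_descent C p"
    and "preserves_pullbacks_along A C L (ArrMap U p)"
  shows "effective_descent A (ArrMap U p)"
proof -
  interpret adjunction A C L U \<eta> \<epsilon> by (rule assms(1))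
  interpret cartesian_monic_coreflection A C L U \<eta> \<epsilon>
    by unfold_locales (use assms(2-4) in auto)
  obtain P \<eta>' \<epsilon>' where p: "p \<in> Arr C" and
    m: "monadic_adjunction (slice C (Dom C p)) (slice C (Cod C p)) (slice_post C p) P \<eta>' \<epsilon>'"
    using assms(5) effective_descent_iff[OF F.B.category_axioms] by blast
  then have adj: "adjunction (slice C (Dom C p)) (slice C (Cod C p)) (slice_post C p) P \<eta>' \<epsilon>'"
    by (simp add: monadic_adjunction_def)
  obtain P' \<eta>'' \<epsilon>'' where
    "monadic_adjunction (slice A (ObjMap U (Dom C p))) (slice A (ObjMap U (Cod C p)))
      (slice_post A (ArrMap U p)) P' \<eta>'' \<epsilon>''"
    using monadic_adjunction_restricts[OF slice_adjunction_restriction[OF p adj] m]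
      pullback_along_lies_in_image[OF p adj] slice_coreflection[of "Cod C p"] p by auto
  then show ?thesis
    using p unfolding effective_descent_iff[OF F.A.category_axioms] by auto
qed

end
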